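(* For all positive integers $a$, we have $$\mathrm{gr}\,\mathbf{I}(\Pi_{(2^a)})\subseteq\mathrm{gr}\,\mathbf{I}(\Pi_{(a^2)})$$ as ideals of $\mathbb{C}\big[\mathbf{x}_{\binom{[2a]}{2}}\big]$.
   Context: Let $[n]=\{1,\dots,n\}$ and let $\binom{[n]}{2}$ be the set of 2-element subsets of $[n]$. Let $\mathbb{C}\big[\mathbf{x}_{\binom{[n]}{2}}\big]$ be the polynomial ring in the variables $x_{\{i,j\}}=x_{\{j,i\}}$ indexed by $\binom{[n]}{2}$; it is the coordinate ring of $\mathbb{C}^{\binom{[n]}{2}}$. An unordered set partition $\pi$ of $[n]$ is identified with the point $\mathbf{z}\in\mathbb{C}^{\binom{[n]}{2}}$ with $z_{\{i,j\}}=1$ if $i,j$ lie in the same block of $\pi$, and $z_{\{i,j\}}=0$ otherwise. For $\lambda\vdash n$, $\Pi_\lambda\subseteq\mathbb{C}^{\binom{[n]}{2}}$ is the finite set of (points identified with) unordered set partitions of $[n]$ whose multiset of block sizes is given by the parts of $\lambda$. The partition $(b^a)$ is $(b,\dots,b)$ with $a$ copies of $b$; so $\Pi_{(2^a)}$ consists of set partitions of $[2a]$ into $a$ blocks of size $2$, and $\Pi_{(a^2)}$ of set partitions of $[2a]$ into $2$ blocks of size $a$. For a finite set $\mathcal{Z}\subseteq\mathbb{C}^{\binom{[n]}{2}}$, $\mathbf{I}(\mathcal{Z})$ is the ideal of polynomials vanishing on $\mathcal{Z}$; for a nonzero polynomial $f$, $\tau(f)$ is its top-degree homogeneous component; and $\mathrm{gr}\,\mathbf{I}(\mathcal{Z})=\langle\tau(f):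 0\ne f\in\mathbf{I}(\mathcal{Z})\rangle$. *)

theory Defs
  imports
    Complex_Main
    "HOL-Library.Poly_Mapping"
    "HOL-Library.Disjoint_Sets"
    "HOL-Library.FuncSet"
    "HOL-Library.Multiset"
    "HOL-Algebra.Ideal"
begin

text \<open>
  A polynomial is a finitely supported map from monomials to coefficients, and a monomial is a
  finitely supported map from variables to exponents. The ring operations on this type, given by
  \<open>Poly_Mapping\<close>, are the usual ones: multiplication is the convolution product.
\<close>

type_synonym 'v cpoly = "('v \<Rightarrow>\<^sub>0 nat) \<Rightarrow>\<^sub>0 complex"

definition vars :: "'v cpoly \<Rightarrow> 'v set" where
  "vars p = (\<Union>m\<in>Poly_Mapping.keys p. Poly_Mapping.keys m)"

text \<open>The polynomial ring over the complex numbers whose variables are the elements of \<open>E\<close>.\<close>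

definition poly_ring :: "'v set \<Rightarrow> 'v cpoly ring" where
  "poly_ring E = \<lparr>carrier = {p. vars p \<subseteq> E}, monoid.mult = (*), one = 1, zero = 0, add = (+)\<rparr>"

definition poly_eval :: "('v \<Rightarrow> complex) \<Rightarrow> 'v cpoly \<Rightarrow> complex" where
  "poly_eval z p = (\<Sum>m\<in>Poly_Mapping.keys p.
      Poly_Mapping.lookup p m * (\<Prod>v\<in>Poly_Mapping.keys m. z v ^ Poly_Mapping.lookup m v))"

definition monom_degree :: "('v \<Rightarrow>\<^sub>0 nat) \<Rightarrow> nat" where
  "monom_degree m = (\<Sum>v\<in>Poly_Mapping.keys m. Poly_Mapping.lookup m v)"

definition total_degree :: "'v cpoly \<Rightarrow> nat" where
  "total_degree p = Max (monom_degree ` Poly_Mapping.keys p)"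
  \<comment> \<open>only meaningful for nonzero \<open>p\<close>\<close>

definition hom_component :: "nat \<Rightarrow> 'v cpoly \<Rightarrow> 'v cpoly" where
  "hom_component d p = (\<Sum>m\<in>{m \<in> Poly_Mapping.keys p. monom_degree m = d}.
      Poly_Mapping.single m (Poly_Mapping.lookup p m))"

definition top_component :: "'v cpoly \<Rightarrow> 'v cpoly" where
  "top_component p = hom_component (total_degree p) p"

text \<open>
  Points of affine space with coordinates indexed by \<open>E\<close> are the elements of
  \<open>E \<rightarrow>\<^sub>E UNIV\<close>; evaluating an element of \<open>poly_ring E\<close> only uses the coordinates in \<open>E\<close>.
\<close>

definition vanishing_ideal :: "'v set \<Rightarrow> ('v \<Rightarrow> complex) set \<Rightarrow> 'v cpoly set" where
  "vanishing_ideal E Z = {p \<in> carrier (poly_ring E). \<forall>z\<in>Z. poly_eval z p = 0}"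

definition gr_ideal :: "'v set \<Rightarrow> ('v \<Rightarrow> complex) set \<Rightarrow> 'v cpoly set" where
  "gr_ideal E Z = Idl\<^bsub>poly_ring E\<^esub> (top_component ` {f \<in> vanishing_ideal E Z. f \<noteq> 0})"

definition pairs :: "nat \<Rightarrow> nat set set" where
  "pairs n = {e. e \<subseteq> {1..n} \<and> card e = 2}"

definition partition_point :: "nat \<Rightarrow> nat set set \<Rightarrow> (nat set \<Rightarrow> complex)" where
  "partition_point n P = (\<lambda>e\<in>pairs n. if \<exists>B\<in>P. e \<subseteq> B then 1 else 0)"

text \<open>An integer partition \<open>lam\<close> is encoded as the multiset of its parts.\<close>

definition partition_points :: "nat \<Rightarrow> nat multiset \<Rightarrow> (nat set \<Rightarrow> complex) set" where
  "partition_points n lam =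
     partition_point n ` {P. partition_on {1..n} P \<and> image_mset card (mset_set P) = lam}"

text \<open>
  \<open>Idl\<close> is an intersection over all ideals containing a given set, so it is only sensible
  when the ambient structure is a ring and the set lies in its carrier; this is checked here.
\<close>

lemma vars_add: "vars (p + q) \<subseteq> vars p \<union> vars q"
  unfolding vars_def using Poly_Mapping.keys_add[of p q] by blast

lemma vars_mult: "vars (p * q) \<subseteq> vars p \<union> vars q"
proof
  fix v assume "v \<in> vars (p * q)"
  then obtain m where m: "m \<in> Poly_Mapping.keys (p * q)" "v \<in> Poly_Mapping.keys m"
    by (auto simp: vars_def)
  then obtain r s where "m = r + s" "r \<in> Poly_Mapping.keys p" "s \<in> Poly_Mapping.keys q"
    using keys_mult[of p q] by blast
  with m show "v \<in> vars p \<union> vars q"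
    using Poly_Mapping.keys_add[of r s] by (auto simp: vars_def)
qed

lemma poly_ring_simps [simp]:
  "p \<in> carrier (poly_ring E) \<longleftrightarrow> vars p \<subseteq> E"
  "p \<otimes>\<^bsub>poly_ring E\<^esub> q = p * q"
  "p \<oplus>\<^bsub>poly_ring E\<^esub> q = p + q"
  "\<one>\<^bsub>poly_ring E\<^esub> = 1"
  "\<zero>\<^bsub>poly_ring E\<^esub> = 0"
  by (simp_all add: poly_ring_def)

lemma vars_simps [simp]: "vars 0 = {}" "vars 1 = {}" "vars (- p) = vars p"
  by (simp_all add: vars_def)

lemma cring_poly_ring: "cring (poly_ring E)"
proof (rule cringI)
  show "abelian_group (poly_ring E)"
  proof (rule abelian_groupI)
    fix x y assume "x \<in> carrier (poly_ring E)" "y \<in> carrier (poly_ring E)"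
    then show "x \<oplus>\<^bsub>poly_ring E\<^esub> y \<in> carrier (poly_ring E)"
      using vars_add[of x y] by auto
  next
    fix x assume "x \<in> carrier (poly_ring E)"
    then show "\<exists>y\<in>carrier (poly_ring E). y \<oplus>\<^bsub>poly_ring E\<^esub> x = \<zero>\<^bsub>poly_ring E\<^esub>"
      by (intro bexI[of _ "- x"]) auto
  qed (simp_all add: ac_simps)
  show "comm_monoid (poly_ring E)"
  proof (rule comm_monoidI)
    fix x y assume "x \<in> carrier (poly_ring E)" "y \<in> carrier (poly_ring E)"
    then show "x \<otimes>\<^bsub>poly_ring E\<^esub> y \<in> carrier (poly_ring E)"
      using vars_mult[of x y] by auto
  qed (simp_all add: ac_simps)
qed (simp add: distrib_right)

lemma hom_component_keys: "Poly_Mapping.keys (hom_component d p) \<subseteq> Poly_Mapping.keys p"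
proof -
  have "Poly_Mapping.keys (hom_component d p) \<subseteq>
      (\<Union>m\<in>{m \<in> Poly_Mapping.keys p. monom_degree m = d}.
        Poly_Mapping.keys (Poly_Mapping.single m (Poly_Mapping.lookup p m)))"
    unfolding hom_component_def by (rule Poly_Mapping.keys_sum)
  then show ?thesis by (auto split: if_splits)
qed

lemma hom_component_vars: "vars (hom_component d p) \<subseteq> vars p"
  unfolding vars_def by (rule UN_mono[OF hom_component_keys]) simp

lemma ideal_gr_ideal: "ideal (gr_ideal E Z) (poly_ring E)"
proof -
  interpret cring "poly_ring E" by (rule cring_poly_ring)
  have "top_component ` {f \<in> vanishing_ideal E Z. f \<noteq> 0} \<subseteq> carrier (poly_ring E)"
  proof (rule image_subsetI)
    fix f assume "f \<in> {f \<in> vanishing_ideal E Z. f \<noteq> 0}"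
    then have "vars f \<subseteq> E" by (simp add: vanishing_ideal_def)
    then have "vars (top_component f) \<subseteq> E"
      unfolding top_component_def by (rule order_trans[OF hom_component_vars])
    then show "top_component f \<in> carrier (poly_ring E)" by simp
  qed
  then show ?thesis
    unfolding gr_ideal_def by (rule genideal_ideal)
qed

end

theory Submission
  imports Defs
begin

text \<open>
  Let \<open>L\<close> be the associated graded ideal of the bipartitions, and write \<open>\<approx>\<close> for congruence
  modulo \<open>L\<close>. A bipartition is given by signs \<open>s i\<close> with sum zero, through
  \<open>x {i, j} = (1 + s i * s j) / 2\<close>. Modulo lower degree, \<open>x {i, j}\<close> therefore behaves like
  a multiple of \<open>s i * s j\<close> with \<open>s i ^ 2 = 0\<close> and \<open>\<Sum> s i = 0\<close>; this accounts for three kinds of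
  quadratic and linear relations in \<open>L\<close>: two variables whose edges meet have product in \<open>L\<close>,
  the product \<open>x {i, j} * x {k, l}\<close> depends only on the set \<open>{i, j, k, l}\<close> up to \<open>L\<close>,
  and the sum of the variables at each vertex is in \<open>L\<close>
  (\<open>matching_relations_gr_bipartitions\<close>). So a monomial is in \<open>L\<close> unless its support is a
  matching and it is squarefree, and then its class depends only on the vertices that it covers.

  Let \<open>f\<close> of degree \<open>d\<close>
  vanish on all perfect matchings \<open>P\<close>, and let \<open>u P\<close> be the sum of the variables of the edges in
  \<open>P\<close>. Then \<open>0 = (\<Sum>P. f(P) * u P ^ d)\<close>. As a monomial takes the value 1 at \<open>P\<close> if its support
  is contained in \<open>P\<close>, and 0 otherwise, the right-hand side is the sum over the monomials of \<open>f\<close>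
  of their coefficients times \<open>\<Sum>P\<supseteq>m. u P ^ d\<close>, where \<open>m\<close> is the support. The point is
  that this inner sum is \<open>\<approx> 0\<close> if the monomial has degree less than \<open>d\<close>, and otherwise
  is congruent to the monomial times a positive integer that depends only on \<open>a\<close> and \<open>d\<close>
  (\<open>sum_matching_powers_containing_monomial\<close>). Hence a positive multiple of the top component
  of \<open>f\<close> is in \<open>L\<close>.

  To compute the inner sum for a matching \<open>m\<close> that covers the vertex set \<open>B\<close>, write
  \<open>P = m \<union> Q\<close> where \<open>Q\<close> is a perfect matching of the complement \<open>A\<close>, and expand
  \<open>(u m + u Q) ^ d\<close>. With \<open>e(S)\<close> for the sum of all variables of edges inside \<open>S\<close>, the sum of
  \<open>u Q ^ k\<close> over all \<open>Q\<close> is congruent to a multiple of \<open>e(A) ^ k\<close> (\<open>sum_matching_powers\<close>). The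
  linear relations give \<open>e(A) \<approx> e(B)\<close> (\<open>edge_sum_complement\<close>), which moves everything into
  \<open>B\<close>. There, \<open>u m ^ (d - k) * e(B) ^ k\<close> only involves monomials of degree \<open>d\<close> on the \<open>2 * card m\<close>
  vertices of \<open>B\<close>: they are all in \<open>L\<close> if \<open>card m < d\<close>, and each one is in \<open>L\<close> or
  congruent to the monomial of \<open>m\<close> if \<open>card m = d\<close> (\<open>matching_powers\<close>). All coefficients are
  natural numbers, so nothing cancels.
\<close>

section \<open>Perfect matchings\<close>

definition edges :: "'v set \<Rightarrow> 'v set set" where
  "edges A = {e. e \<subseteq> A \<and> card e = 2}"

definition perfect_matchings :: "'v set \<Rightarrow> 'v set set set" where
  "perfect_matchings A = {P. partition_on A P \<and> (\<forall>e\<in>P. card e = 2)}"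

lemma finite_edges: "finite A \<Longrightarrow> finite (edges A)"
  unfolding edges_def by (rule finite_subset[of _ "Pow A"]) auto

lemma finite_perfect_matchings: "finite A \<Longrightarrow> finite (perfect_matchings A)"
  unfolding perfect_matchings_def partition_on_def
  by (rule finite_subset[of _ "Pow (Pow A)"]) auto

lemma perfect_matching_iff:
  "P \<in> perfect_matchings A \<longleftrightarrow> \<Union>P = A \<and> disjoint P \<and> (\<forall>e\<in>P. card e = 2)"
  unfolding perfect_matchings_def partition_on_def by auto

lemma perfect_matching_subset_edges: "P \<in> perfect_matchings A \<Longrightarrow> P \<subseteq> edges A"
  unfolding perfect_matching_iff edges_def by auto

lemma finite_perfect_matching:
  assumes "finite A" "P \<in> perfect_matchings A" shows "finite P"
  using finite_subset[OF perfect_matching_subset_edges[OF assms(2)] finite_edges[OF assms(1)]] .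

lemma card_perfect_matching:
  assumes "finite A" "P \<in> perfect_matchings A"
  shows "card A = 2 * card P"
proof -
  have "finite e" if "e \<in> P" for e
    using that assms(2) card.infinite[of e] unfolding perfect_matching_iff by fastforce
  then have "card (\<Union>P) = sum card P"
    using assms(2) by (intro card_Union_disjoint) (auto simp: perfect_matching_iff)
  then show ?thesis using assms by (simp add: perfect_matching_iff)
qed

lemma perfect_matching_empty: "perfect_matchings {} = {{}}"
proof -
  have "P = {}" if "P \<in> perfect_matchings {}" for P
    using that by (fastforce simp: perfect_matching_iff)
  moreover have "{} \<in> perfect_matchings {}" by (simp add: perfect_matching_iff)
  ultimately show ?thesis by blast
qed

lemma perfect_matching_subset:
  "P \<in> perfect_matchings A \<Longrightarrow> m \<subseteq> P \<Longrightarrow> m \<in> perfect_matchings (\<Union>m)"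
  unfolding perfect_matching_iff by (auto intro!: disjointI dest: disjointD)

lemma perfect_matching_diff:
  assumes "P \<in> perfect_matchings A" "m \<subseteq> P"
  shows "P - m \<in> perfect_matchings (A - \<Union>m)"
proof -
  have "\<Union>(P - m) = A - \<Union>m"
  proof -
    have "e \<inter> e' = {}" if "e \<in> P - m" "e' \<in> m" for e e'
      using that assms disjointD[of P e e'] unfolding perfect_matching_iff by blast
    moreover have "\<Union>P = A" using assms(1) by (simp add: perfect_matching_iff)
    ultimately show ?thesis using assms(2) by blast
  qed
  moreover have "disjoint (P - m)"
    using assms unfolding perfect_matching_iff by (auto intro!: disjointI dest: disjointD)
  ultimately show ?thesis using assms unfolding perfect_matching_iff by auto
qed

lemma perfect_matching_un:
  assumes "m \<in> perfect_matchings B" "Q \<in> perfect_matchings (A - B)" "B \<subseteq> A"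
  shows "m \<union> Q \<in> perfect_matchings A" "m \<inter> Q = {}"
proof -
  have ne: "e \<noteq> {}" if "e \<in> m \<union> Q" for e
    using that assms unfolding perfect_matching_iff by auto
  have *: "e \<inter> e' = {}" if "e \<in> m" "e' \<in> Q" for e e'
    using that assms unfolding perfect_matching_iff by blast
  then show "m \<inter> Q = {}" using ne by blast
  have "\<Union>(m \<union> Q) = A" using assms unfolding perfect_matching_iff by auto
  moreover have "disjoint (m \<union> Q)"
    using assms * unfolding perfect_matching_iff disjoint_def by (metis Un_iff inf_commute)
  ultimately show "m \<union> Q \<in> perfect_matchings A"
    using assms(1,2) unfolding perfect_matching_iff by auto
qed

lemma sum_perfect_matchings_containing:
  assumes "m \<in> perfect_matchings B" "B \<subseteq> A"
  shows "(\<Sum>P\<in>{P \<in> perfect_matchings A. m \<subseteq> P}. g P) = (\<Sum>Q\<in>perfect_matchings (A - B). g (m \<union> Q))"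
proof (rule sum.reindex_bij_witness[where i = "\<lambda>Q. m \<union> Q" and j = "\<lambda>P. P - m"])
  fix P assume P: "P \<in> {P \<in> perfect_matchings A. m \<subseteq> P}"
  then show "m \<union> (P - m) = P" by auto
  then show "g (m \<union> (P - m)) = g P" by simp
  show "P - m \<in> perfect_matchings (A - B)"
    using perfect_matching_diff[of P A m] P assms by (simp add: perfect_matching_iff)
next
  fix Q assume Q: "Q \<in> perfect_matchings (A - B)"
  show "m \<union> Q - m = Q" using perfect_matching_un(2)[OF assms(1) Q assms(2)] by auto
  show "m \<union> Q \<in> {P \<in> perfect_matchings A. m \<subseteq> P}"
    using perfect_matching_un(1)[OF assms(1) Q assms(2)] by auto
qed

lemma single_perfect_matching: "e \<in> edges A \<Longrightarrow> {e} \<in> perfect_matchings e"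
  by (auto simp: perfect_matching_iff edges_def)

text \<open>
  Double counting of the pairs of a perfect matching and one of its edges. Both the number of
  perfect matchings and their power sums below are found by induction through this identity.
\<close>
lemma sum_edges_of_perfect_matchings:
  assumes "finite A"
  shows "(\<Sum>P\<in>perfect_matchings A. \<Sum>e\<in>P. g e (P - {e})) =
         (\<Sum>e\<in>edges A. \<Sum>Q\<in>perfect_matchings (A - e). g e Q)"
proof -
  have "(\<Sum>P\<in>perfect_matchings A. \<Sum>e\<in>P. g e (P - {e})) =
        (\<Sum>P\<in>perfect_matchings A. \<Sum>e\<in>{e \<in> edges A. e \<in> P}. g e (P - {e}))"
  proof (rule sum.cong[OF refl])
    fix P assume "P \<in> perfect_matchings A"
    then have "{e \<in> edges A. e \<in> P} = P" using perfect_matching_subset_edges by blast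
    then show "(\<Sum>e\<in>P. g e (P - {e})) = (\<Sum>e\<in>{e \<in> edges A. e \<in> P}. g e (P - {e}))" by simp
  qed
  also have "\<dots> = (\<Sum>e\<in>edges A. \<Sum>P\<in>{P \<in> perfect_matchings A. e \<in> P}. g e (P - {e}))"
    by (rule sum.swap_restrict[OF finite_perfect_matchings finite_edges, OF assms assms])
  also have "\<dots> = (\<Sum>e\<in>edges A. \<Sum>Q\<in>perfect_matchings (A - e). g e Q)"
  proof (rule sum.cong[OF refl])
    fix e assume e: "e \<in> edges A"
    then have eA: "e \<subseteq> A" by (simp add: edges_def)
    have "(\<Sum>P\<in>{P \<in> perfect_matchings A. e \<in> P}. g e (P - {e})) =
          (\<Sum>Q\<in>perfect_matchings (A - e). g e (({e} \<union> Q) - {e}))"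
      using sum_perfect_matchings_containing[OF single_perfect_matching[OF e] eA,
          of "\<lambda>P. g e (P - {e})"] by simp
    also have "\<dots> = (\<Sum>Q\<in>perfect_matchings (A - e). g e Q)"
    proof (rule sum.cong[OF refl])
      fix Q assume "Q \<in> perfect_matchings (A - e)"
      then have "{e} \<union> Q - {e} = Q"
        using perfect_matching_un(2)[OF single_perfect_matching[OF e] _ eA] by blast
      then show "g e (({e} \<union> Q) - {e}) = g e Q" by simp
    qed
    finally show "(\<Sum>P\<in>{P \<in> perfect_matchings A. e \<in> P}. g e (P - {e})) =
      (\<Sum>Q\<in>perfect_matchings (A - e). g e Q)" .
  qed
  finally show ?thesis .
qed

lemma card_edges: "finite A \<Longrightarrow> card (edges A) = card A choose 2"
  unfolding edges_def by (rule n_subsets)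

lemma card_diff_edge: "finite A \<Longrightarrow> e \<in> edges A \<Longrightarrow> card (A - e) = card A - 2"
  unfolding edges_def by (auto simp: card_Diff_subset finite_subset)

text \<open>The double factorial \<open>(2 r - 1)!!\<close>.\<close>
fun odd_fact :: "nat \<Rightarrow> nat" where
  "odd_fact 0 = 1"
| "odd_fact (Suc r) = (2 * r + 1) * odd_fact r"

lemma odd_fact_pos: "odd_fact r > 0"
  by (induction r) auto

lemma choose_two_double: "(2 * Suc r) choose 2 = Suc r * (2 * r + 1)"
  by (simp add: choose_two)

lemma card_perfect_matchings:
  "finite A \<Longrightarrow> card A = 2 * r \<Longrightarrow> card (perfect_matchings A) = odd_fact r"
proof (induction r arbitrary: A)
  case 0
  then show ?case by (simp add: perfect_matching_empty)
next
  case (Suc r)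
  have "Suc r * card (perfect_matchings A) = (\<Sum>P\<in>perfect_matchings A. \<Sum>e\<in>P. (1::nat))"
  proof -
    have "card P = Suc r" if "P \<in> perfect_matchings A" for P
      using card_perfect_matching[OF Suc.prems(1) that] Suc.prems(2) by simp
    then show ?thesis by simp
  qed
  also have "\<dots> = (\<Sum>e\<in>edges A. \<Sum>Q\<in>perfect_matchings (A - e). 1)"
    using sum_edges_of_perfect_matchings[OF Suc.prems(1), of "\<lambda>_ _. 1::nat"] by simp
  also have "\<dots> = (\<Sum>e\<in>edges A. odd_fact r)"
    using Suc by (intro sum.cong) (simp_all add: card_diff_edge)
  also have "\<dots> = Suc r * ((2 * r + 1) * odd_fact r)"
    using card_edges[OF Suc.prems(1)] Suc.prems(2) choose_two_double[of r] 
    by (simp only: sum_constant of_nat_id mult.assoc)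
  finally show ?case by (simp only: odd_fact.simps) (metis mult_left_cancel nat.distinct(1))
qed

section \<open>Congruences modulo an ideal of a subring\<close>

text \<open>
  The polynomials in a given set of variables form a subring of the type of all polynomials.
  Congruence therefore includes membership in the subring \<open>R\<close>, so that it is preserved by
  products, although it is reflexive only on \<open>R\<close>.
\<close>
locale subring_ideal =
  fixes R L :: "'r::comm_ring_1 set"
  assumes R_one [intro, simp]: "1 \<in> R"
    and R_add [intro]: "p \<in> R \<Longrightarrow> q \<in> R \<Longrightarrow> p + q \<in> R"
    and R_mult [intro]: "p \<in> R \<Longrightarrow> q \<in> R \<Longrightarrow> p * q \<in> R"
    and R_minus [intro]: "p \<in> R \<Longrightarrow> - p \<in> R"
    and L_sub: "L \<subseteq> R"
    and L_zero [intro, simp]: "0 \<in> L"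
    and L_add [intro]: "p \<in> L \<Longrightarrow> q \<in> L \<Longrightarrow> p + q \<in> L"
    and L_mult [intro]: "p \<in> R \<Longrightarrow> q \<in> L \<Longrightarrow> p * q \<in> L"
begin

definition cong (infix "\<approx>" 50) where
  "p \<approx> q \<longleftrightarrow> p \<in> R \<and> q \<in> R \<and> p - q \<in> L"

lemma R_zero [intro, simp]: "0 \<in> R"
  using L_sub L_zero by blast

lemma R_sum [intro]: "(\<And>i. i \<in> I \<Longrightarrow> f i \<in> R) \<Longrightarrow> sum f I \<in> R"
  by (induction I rule: infinite_finite_induct) auto

lemma R_prod [intro]: "(\<And>i. i \<in> I \<Longrightarrow> f i \<in> R) \<Longrightarrow> prod f I \<in> R"
  by (induction I rule: infinite_finite_induct) auto

lemma R_power [intro]: "p \<in> R \<Longrightarrow> p ^ k \<in> R"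
  by (induction k) auto

lemma R_of_nat [intro, simp]: "of_nat k \<in> R"
  by (induction k) auto

lemma L_minus: "p \<in> L \<Longrightarrow> - p \<in> L"
  using L_mult[of "-1" p] by auto

lemma L_sum: "(\<And>i. i \<in> I \<Longrightarrow> f i \<in> L) \<Longrightarrow> sum f I \<in> L"
  by (induction I rule: infinite_finite_induct) auto

lemma cong_refl [intro]: "p \<in> R \<Longrightarrow> p \<approx> p"
  by (simp add: cong_def)

lemma cong_sym: "p \<approx> q \<Longrightarrow> q \<approx> p"
  unfolding cong_def using L_minus[of "p - q"] by simp

lemma cong_trans [trans]: "p \<approx> q \<Longrightarrow> q \<approx> r \<Longrightarrow> p \<approx> r"
  unfolding cong_def using L_add[of "p - q" "q - r"] by simp

lemma cong_mult:
  assumes "p \<approx> q" "r \<approx> s" shows "p * r \<approx> q * s"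
proof -
  have "r * (p - q) + q * (r - s) \<in> L" using assms unfolding cong_def by blast
  then show ?thesis using assms unfolding cong_def by (auto simp: algebra_simps)
qed

lemma cong_power: "p \<approx> q \<Longrightarrow> p ^ k \<approx> q ^ k"
  by (induction k) (auto intro: cong_mult)

lemma cong_add: "p \<approx> q \<Longrightarrow> r \<approx> s \<Longrightarrow> p + r \<approx> q + s"
  unfolding cong_def using L_add[of "p - q" "r - s"] by (auto simp: algebra_simps)

lemma cong_sum: "(\<And>i. i \<in> I \<Longrightarrow> f i \<approx> g i) \<Longrightarrow> sum f I \<approx> sum g I"
  by (induction I rule: infinite_finite_induct) (auto intro: cong_add)

lemma cong_zero_iff: "p \<approx> 0 \<longleftrightarrow> p \<in> L"
  using L_sub by (auto simp: cong_def)

lemma cong_mult_left: "p \<in> R \<Longrightarrow> q \<approx> r \<Longrightarrow> p * q \<approx> p * r"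
  by (intro cong_mult cong_refl)

text \<open>
  Each of the \<open>k\<close> factors is replaced in turn, next to the same \<open>t\<close>. With \<open>t = x e\<close>, this
  deletes all edges that meet \<open>e\<close> from a power of a sum of edges.
\<close>
lemma cong_mult_power:
  assumes "t \<in> R" "t * p \<approx> t * q" "p \<in> R" "q \<in> R"
  shows "t * p ^ k \<approx> t * q ^ k"
proof (induction k)
  case 0
  show ?case using assms by auto
next
  case (Suc k)
  have "p * (t * p ^ k) \<approx> p * (t * q ^ k)" by (rule cong_mult_left[OF assms(3) Suc])
  moreover have "q ^ k * (t * p) \<approx> q ^ k * (t * q)"
    by (rule cong_mult_left[OF R_power[OF assms(4)] assms(2)])
  ultimately show ?case
    using cong_trans[of "p * (t * p ^ k)" "p * (t * q ^ k)" "q ^ k * (t * q)"]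
    by (simp add: mult_ac)
qed

end

section \<open>Sums over perfect matchings in a ring with matching relations\<close>

text \<open>
  For a matching with \<open>r \<le> j + k\<close> edges that covers \<open>B\<close>, this is the factor in front of its monomial in
  the \<open>j\<close>-th power of the sum of its edges times the \<open>k\<close>-th power of the sum of all edges inside
  \<open>B\<close>. Each step chooses the edge contributed by one factor, among \<open>r\<close> or \<open>2 * r choose 2\<close>
  edges, and deletes its two ends.
\<close>
fun matching_coeff :: "nat \<Rightarrow> nat \<Rightarrow> nat \<Rightarrow> nat" where
  "matching_coeff 0 0 r = 1"
| "matching_coeff 0 (Suc k) r = (2 * r choose 2) * matching_coeff 0 k (r - 1)"
| "matching_coeff (Suc j) k r = r * matching_coeff j k (r - 1)"

lemma matching_coeff_eq_0: "r < j + k \<Longrightarrow> matching_coeff j k r = 0"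
proof (induction j k r rule: matching_coeff.induct)
  case (2 k r)
  then show ?case by (cases r) auto
next
  case (3 j k r)
  then show ?case by (cases r) auto
qed simp

lemma matching_coeff_pos: "matching_coeff j 0 j > 0"
  by (induction j) auto

text \<open>
  The corresponding factor for the sum of the \<open>d\<close>-th powers over all perfect matchings, of
  \<open>2 * h\<close> vertices, that contain a given matching with \<open>r\<close> edges. If \<open>k > h - r\<close>, the difference
  \<open>h - r - k\<close> is truncated, which is harmless: more than \<open>h - r\<close> edges outside the matching
  cannot be disjoint.
\<close>
definition containing_coeff :: "nat \<Rightarrow> nat \<Rightarrow> nat \<Rightarrow> nat" where
  "containing_coeff h d r =
     (\<Sum>k\<le>d. (d choose k) * odd_fact (h - r - k) * matching_coeff (d - k) k r)"

lemma containing_coeff_eq_0: "r < d \<Longrightarrow> containing_coeff h d r = 0"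
  unfolding containing_coeff_def by (simp add: matching_coeff_eq_0)

lemma containing_coeff_pos: "containing_coeff h d d > 0"
proof -
  have "0 < (d choose 0) * odd_fact (h - d - 0) * matching_coeff (d - 0) 0 d"
    by (simp add: odd_fact_pos matching_coeff_pos)
  also have "\<dots> \<le> containing_coeff h d d"
    unfolding containing_coeff_def
    by (rule member_le_sum[where f = "\<lambda>k. (d choose k) * odd_fact (h - d - k) * matching_coeff (d - k) k d"]) auto
  finally show ?thesis .
qed

text \<open>
  In the model \<open>x {i, j} = s i * s j\<close>, the assumptions \<open>L_meeting\<close>, \<open>L_star\<close> and \<open>L_swap\<close> hold
  because \<open>s i ^ 2 = 0\<close>, because \<open>\<Sum> s i = 0\<close>, and because multiplication commutes.
  The assumption \<open>L_half\<close> is needed to compare the edges inside a set with those inside its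
  complement, as counting edges by their ends counts each of them twice.
\<close>
locale matching_relations = subring_ideal R L for R L :: "'r::comm_ring_1 set" +
  fixes V :: "'v set" and x :: "'v set \<Rightarrow> 'r"
  assumes finite_V: "finite V"
    and x_R: "e \<in> edges V \<Longrightarrow> x e \<in> R"
    and L_meeting: "e \<in> edges V \<Longrightarrow> e' \<in> edges V \<Longrightarrow> e \<inter> e' \<noteq> {} \<Longrightarrow> x e * x e' \<in> L"
    and L_star: "v \<in> V \<Longrightarrow> (\<Sum>e\<in>{e \<in> edges V. v \<in> e}. x e) \<in> L"
    and L_swap: "{i, j, k, l} \<subseteq> V \<Longrightarrow> card {i, j, k, l} = 4 \<Longrightarrow>
       x {i, j} * x {k, l} - x {i, k} * x {j, l} \<in> L"
    and L_half: "p \<in> R \<Longrightarrow> p + p \<in> L \<Longrightarrow> p \<in> L"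
begin

definition edge_sum :: "'v set set \<Rightarrow> 'r" where
  "edge_sum S = (\<Sum>e\<in>S. x e)"

lemma edge_sum_R [intro]: "S \<subseteq> edges V \<Longrightarrow> edge_sum S \<in> R"
  unfolding edge_sum_def using x_R by blast

lemma prod_x_R [intro]: "S \<subseteq> edges V \<Longrightarrow> prod x S \<in> R"
  using x_R by blast

lemma edges_mono: "A \<subseteq> V \<Longrightarrow> edges A \<subseteq> edges V"
  unfolding edges_def by auto

lemma perfect_matching_edges_V: "A \<subseteq> V \<Longrightarrow> P \<in> perfect_matchings A \<Longrightarrow> P \<subseteq> edges V"
  using edges_mono perfect_matching_subset_edges by blast

lemma x_mult_edge_sum:
  assumes "e \<in> edges V" "S \<subseteq> edges V" "T \<subseteq> S" "\<And>e'. e' \<in> S - T \<Longrightarrow> e \<inter> e' \<noteq> {}"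
  shows "x e * edge_sum S \<approx> x e * edge_sum T"
proof -
  have fin: "finite S" using assms(2) finite_edges[OF finite_V] by (rule finite_subset)
  have "edge_sum S = edge_sum (S - T) + edge_sum T"
    unfolding edge_sum_def using assms(3) fin by (rule sum.subset_diff)
  then have "x e * edge_sum S - x e * edge_sum T = (\<Sum>e'\<in>S - T. x e * x e')"
    by (simp add: algebra_simps edge_sum_def sum_distrib_left)
  also have "\<dots> \<in> L"
    using assms by (intro L_sum L_meeting) auto
  finally show ?thesis
    using assms(2,3) x_R[OF assms(1)] R_mult edge_sum_R[of S] edge_sum_R[of T]
    unfolding cong_def by blast
qed

lemma x_mult_edge_sum_power:
  assumes "e \<in> edges V" "S \<subseteq> edges V" "T \<subseteq> S" "\<And>e'. e' \<in> S - T \<Longrightarrow> e \<inter> e' \<noteq> {}"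
  shows "x e * edge_sum S ^ k \<approx> x e * edge_sum T ^ k"
  using assms x_R by (intro cong_mult_power x_mult_edge_sum) auto

lemma x_mult_all_edges_power:
  assumes "A \<subseteq> V" "e \<in> edges V"
  shows "x e * edge_sum (edges A) ^ k \<approx> x e * edge_sum (edges (A - e)) ^ k"
  using assms edges_mono[OF assms(1)]
  by (intro x_mult_edge_sum_power) (auto simp: edges_def)

lemma x_mult_matching_power:
  assumes "A \<subseteq> V" "m \<in> perfect_matchings A" "e \<in> m"
  shows "x e * edge_sum m ^ k \<approx> x e * edge_sum (m - {e}) ^ k"
proof -
  have "card e = 2" using assms by (simp add: perfect_matching_iff)
  then have "e \<noteq> {}" by auto
  then show ?thesis
    using assms perfect_matching_edges_V[OF assms(1,2)] by (intro x_mult_edge_sum_power) auto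
qed

text \<open>
  The induction on \<open>k\<close> splits off one factor \<open>x e\<close>. It annihilates the other edges at the ends of
  \<open>e\<close>, so \<open>P\<close> can be replaced by \<open>P - {e}\<close>, a perfect matching of \<open>A - e\<close>; after the induction
  hypothesis, the edges at \<open>e\<close> are put back in the same way. For \<open>k = 0\<close> the claim is the number
  of perfect matchings.
\<close>
lemma sum_matching_powers:
  assumes "A \<subseteq> V" "card A = 2 * r"
  shows "(\<Sum>P\<in>perfect_matchings A. edge_sum P ^ k) \<approx>
         of_nat (odd_fact (r - k)) * edge_sum (edges A) ^ k"
  using assms
proof (induction k arbitrary: A r)
  case 0
  have "finite A" using 0 finite_V finite_subset by blast
  then show ?case using 0 by (auto simp: card_perfect_matchings)
next
  case (Suc k)
  have finA: "finite A" using Suc.prems finite_V finite_subset by blast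
  have EA: "edges A \<subseteq> edges V" using Suc.prems(1) by (rule edges_mono)
  have eV: "e \<in> edges V" if "e \<in> edges A" for e using that EA by blast
  have IH: "(\<Sum>Q\<in>perfect_matchings (A - e). edge_sum Q ^ k) \<approx>
      of_nat (odd_fact (r - Suc k)) * edge_sum (edges (A - e)) ^ k" if e: "e \<in> edges A" for e
  proof -
    have "card (A - e) = 2 * (r - 1)"
      using card_diff_edge[OF finA e] Suc.prems(2) by simp
    then show ?thesis using Suc.IH[of "A - e" "r - 1"] Suc.prems(1) by auto
  qed
  have "(\<Sum>P\<in>perfect_matchings A. edge_sum P ^ Suc k) =
        (\<Sum>P\<in>perfect_matchings A. \<Sum>e\<in>P. x e * edge_sum P ^ k)"
    by (simp add: edge_sum_def sum_distrib_right)
  also have "\<dots> \<approx> (\<Sum>P\<in>perfect_matchings A. \<Sum>e\<in>P. x e * edge_sum (P - {e}) ^ k)"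
    using Suc.prems(1) by (intro cong_sum x_mult_matching_power)
  also have "\<dots> = (\<Sum>e\<in>edges A. \<Sum>Q\<in>perfect_matchings (A - e). x e * edge_sum Q ^ k)"
    by (rule sum_edges_of_perfect_matchings[OF finA])
  also have "\<dots> = (\<Sum>e\<in>edges A. x e * (\<Sum>Q\<in>perfect_matchings (A - e). edge_sum Q ^ k))"
    by (simp add: sum_distrib_left)
  also have "\<dots> \<approx> (\<Sum>e\<in>edges A. x e *
      (of_nat (odd_fact (r - Suc k)) * edge_sum (edges (A - e)) ^ k))"
    by (intro cong_sum cong_mult_left IH x_R eV)
  also have "\<dots> = (\<Sum>e\<in>edges A. of_nat (odd_fact (r - Suc k)) *
      (x e * edge_sum (edges (A - e)) ^ k))"
    by (simp add: mult_ac)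
  also have "\<dots> \<approx> (\<Sum>e\<in>edges A. of_nat (odd_fact (r - Suc k)) *
      (x e * edge_sum (edges A) ^ k))"
    using Suc.prems(1) eV
    by (intro cong_sum cong_mult_left cong_sym[OF x_mult_all_edges_power]) auto
  also have "\<dots> = of_nat (odd_fact (r - Suc k)) * edge_sum (edges A) ^ Suc k"
    by (simp add: edge_sum_def sum_distrib_right sum_distrib_left mult_ac)
  finally show ?case .
qed

text \<open>
  An edge \<open>e\<close> outside \<open>m\<close> joins two edges \<open>{i, k}\<close> and \<open>{j, l}\<close> of \<open>m\<close>; exchanging these for
  \<open>e = {i, j}\<close> and \<open>{k, l}\<close> does not change the monomial modulo \<open>L\<close>.
\<close>
lemma matching_swap:
  assumes "B \<subseteq> V" "m \<in> perfect_matchings B" "e \<in> edges B"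
  obtains m' where "m' \<in> perfect_matchings (B - e)" "x e * prod x m' \<approx> prod x m"
proof (cases "e \<in> m")
  case True
  have fin: "finite m"
    by (rule finite_perfect_matching[OF finite_subset[OF assms(1) finite_V] assms(2)])
  have "m - {e} \<in> perfect_matchings (B - e)"
    using perfect_matching_diff[OF assms(2), of "{e}"] True by simp
  moreover have "x e * prod x (m - {e}) = prod x m"
    using True fin by (simp add: prod.remove)
  moreover have "prod x m \<in> R"
    using perfect_matching_edges_V[OF assms(1,2)] by blast
  ultimately show thesis using that cong_refl by metis
next
  case False
  have fin: "finite m"
    by (rule finite_perfect_matching[OF finite_subset[OF assms(1) finite_V] assms(2)])
  note m = assms(2)[unfolded perfect_matching_iff]
  obtain i j where e: "e = {i, j}" "i \<noteq> j" 
    using assms(3) unfolding edges_def by (auto simp: card_2_iff)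
  have ij: "i \<in> B" "j \<in> B" using assms(3) e by (auto simp: edges_def)
  have partner: "\<exists>w. {v, w} \<in> m \<and> w \<noteq> v" if v: "v \<in> B" for v
  proof -
    obtain b where b: "b \<in> m" "v \<in> b" using m v by blast
    then obtain w where "b = {v, w}" "w \<noteq> v" using m by (metis card_2_iff insertE singletonD insert_commute)
    then show ?thesis using b by blast
  qed
  obtain k where k: "{i, k} \<in> m" "k \<noteq> i" using partner ij by blast
  obtain l where l: "{j, l} \<in> m" "l \<noteq> j" using partner ij by blast
  have ne: "{i, k} \<noteq> {j, l}" using False k l e by (auto simp: doubleton_eq_iff)
  then have disj: "{i, k} \<inter> {j, l} = {}" using m k(1) l(1) by (meson disjointD)
  have four: "card {i, j, k, l} = 4" using disj k l e by auto
  have klB: "k \<in> B" "l \<in> B" using m k l by auto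
  define m0 where "m0 = m - {{i, k}, {j, l}}"
  have m0: "m0 \<in> perfect_matchings (B - {i, j, k, l})"
  proof -
    have "m0 \<in> perfect_matchings (B - \<Union>{{i, k}, {j, l}})"
      unfolding m0_def using k l by (intro perfect_matching_diff[OF assms(2)]) auto
    moreover have "\<Union>{{i, k}, {j, l}} = {i, j, k, l}" by auto
    ultimately show ?thesis by simp
  qed
  have fin0: "finite m0" using fin by (simp add: m0_def)
  have kl: "k \<noteq> l" using disj by auto
  have "{{k, l}} \<in> perfect_matchings {k, l}"
    using kl by (auto simp: perfect_matching_iff)
  moreover have "B - e - {k, l} = B - {i, j, k, l}" using e by auto
  moreover have "{k, l} \<subseteq> B - e" using klB disj k l e by auto
  ultimately have m': "{{k, l}} \<union> m0 \<in> perfect_matchings (B - e)" and nin: "{{k, l}} \<inter> m0 = {}"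
    using perfect_matching_un[of "{{k, l}}" "{k, l}" m0 "B - e"] m0 by simp_all
  have pm: "prod x m = prod x m0 * (x {i, k} * x {j, l})"
  proof -
    have "m = insert {i, k} (insert {j, l} m0)" using k l unfolding m0_def by auto
    moreover have "{i, k} \<notin> insert {j, l} m0" "{j, l} \<notin> m0" using ne by (auto simp: m0_def)
    ultimately show ?thesis using fin0 by (simp add: mult_ac)
  qed
  have pm': "x e * prod x ({{k, l}} \<union> m0) = prod x m0 * (x {i, j} * x {k, l})"
    using nin fin0 e by (simp add: mult_ac)
  have mR: "prod x m0 \<in> R" 
    using perfect_matching_edges_V[OF assms(1,2)] unfolding m0_def by blast
  have ed: "{i, j} \<in> edges V" "{k, l} \<in> edges V" "{i, k} \<in> edges V" "{j, l} \<in> edges V"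
    using ij klB assms(1) e kl k l by (auto simp: edges_def)
  have "x {i, j} * x {k, l} \<approx> x {i, k} * x {j, l}"
  proof -
    have "{i, j, k, l} \<subseteq> V" using ij klB assms(1) by auto
    then show ?thesis
      using L_swap[of i j k l] four R_mult[OF x_R x_R] ed unfolding cong_def by blast
  qed
  then have "x e * prod x ({{k, l}} \<union> m0) \<approx> prod x m"
    unfolding pm pm' by (rule cong_mult_left[OF mR])
  then show thesis by (rule that[OF m'])
qed

text \<open>
  The bound \<open>card m \<le> j + k\<close> makes every monomial on the left have at least as many edges as
  fit into \<open>B\<close> without meeting. If it is strict, all of them are in \<open>L\<close>, in accordance with
  \<open>matching_coeff_eq_0\<close>.
\<close>
lemma matching_powers:
  assumes "B \<subseteq> V" "m \<in> perfect_matchings B" "card m \<le> j + k"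
  shows "edge_sum m ^ j * edge_sum (edges B) ^ k \<approx>
         of_nat (matching_coeff j k (card m)) * prod x m"
  using assms
proof (induction j k "card m" arbitrary: B m rule: matching_coeff.induct)
  case (1 m B)
  have "finite m"
    by (rule finite_perfect_matching[OF finite_subset[OF "1.prems"(1) finite_V] "1.prems"(2)])
  then have "m = {}" using 1 by simp
  then show ?case by auto
next
  case (2 k m B)
  have finB: "finite B" using "2.prems"(1) finite_V by (rule finite_subset)
  have EB: "edges B \<subseteq> edges V" using "2.prems"(1) by (rule edges_mono)
  have mR: "prod x m \<in> R"
    by (rule prod_x_R[OF perfect_matching_edges_V[OF "2.prems"(1,2)]])
  let ?c = "of_nat (matching_coeff 0 k (card m - 1)) :: 'r"
  have step: "x e * edge_sum (edges B) ^ k \<approx> ?c * prod x m" if e: "e \<in> edges B" for e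
  proof -
    obtain m' where m': "m' \<in> perfect_matchings (B - e)" "x e * prod x m' \<approx> prod x m"
      using matching_swap "2.prems" e by metis
    have "2 * card m' = 2 * card m - 2"
      using card_perfect_matching[OF finB "2.prems"(2)] card_diff_edge[OF finB e]
        card_perfect_matching[OF _ m'(1)] finB by simp
    then have cm: "card m' = card m - 1" by simp
    have eV: "e \<in> edges V" using e EB by blast
    have "edge_sum (edges (B - e)) ^ k \<approx> ?c * prod x m'"
    proof -
      have "B - e \<subseteq> V" "card m' \<le> 0 + k" using "2.prems" cm by auto
      then show ?thesis using "2.hyps"[OF cm[symmetric], of "B - e"] m'(1) cm by simp
    qed
    then have "x e * edge_sum (edges (B - e)) ^ k \<approx> x e * (?c * prod x m')"
      using x_R eV by (intro cong_mult_left)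
    also have "x e * (?c * prod x m') = ?c * (x e * prod x m')" by (simp add: mult_ac)
    also have "\<dots> \<approx> ?c * prod x m" by (rule cong_mult_left[OF _ m'(2)]) simp
    finally show ?thesis
      using cong_trans x_mult_all_edges_power[OF "2.prems"(1) eV] by blast
  qed
  have "edge_sum (edges B) ^ Suc k = (\<Sum>e\<in>edges B. x e * edge_sum (edges B) ^ k)"
    by (simp add: edge_sum_def sum_distrib_right)
  also have "\<dots> \<approx> (\<Sum>e\<in>edges B. ?c * prod x m)"
    using step by (rule cong_sum)
  also have "\<dots> = of_nat (matching_coeff 0 (Suc k) (card m)) * prod x m"
    using card_edges[OF finB] card_perfect_matching[OF finB "2.prems"(2)]
    by (simp add: mult_ac)
  finally show ?case by simp
next
  case (3 j k m B)
  have finB: "finite B" using "3.prems"(1) finite_V by (rule finite_subset)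
  have finm: "finite m" using finite_perfect_matching[OF finB "3.prems"(2)] .
  have mV: "m \<subseteq> edges V" by (rule perfect_matching_edges_V[OF "3.prems"(1,2)])
  have EB: "edges B \<subseteq> edges V" using "3.prems"(1) by (rule edges_mono)
  let ?c = "of_nat (matching_coeff j k (card m - 1)) :: 'r"
  have step: "x e * (edge_sum m ^ j * edge_sum (edges B) ^ k) \<approx> ?c * prod x m"
    if e: "e \<in> m" for e
  proof -
    have eV: "e \<in> edges V" using e mV by blast
    have m': "m - {e} \<in> perfect_matchings (B - e)"
      using perfect_matching_diff[OF "3.prems"(2), of "{e}"] e by simp
    have cm: "card (m - {e}) = card m - 1" using e finm by simp
    have sub: "m - {e} \<subseteq> edges V" "edges (B - e) \<subseteq> edges V"
      using mV EB by (auto simp: edges_def)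
    have "(x e * edge_sum m ^ j) * edge_sum (edges B) ^ k
        \<approx> (x e * edge_sum (m - {e}) ^ j) * edge_sum (edges B) ^ k"
      by (rule cong_mult[OF x_mult_matching_power[OF "3.prems"(1,2) e]
            cong_refl[OF R_power[OF edge_sum_R[OF EB]]]])
    also have "\<dots> = edge_sum (m - {e}) ^ j * (x e * edge_sum (edges B) ^ k)"
      by (simp add: mult_ac)
    also have "\<dots> \<approx> edge_sum (m - {e}) ^ j * (x e * edge_sum (edges (B - e)) ^ k)"
      using sub by (intro cong_mult_left x_mult_all_edges_power "3.prems" eV) auto
    also have "\<dots> = x e * (edge_sum (m - {e}) ^ j * edge_sum (edges (B - e)) ^ k)"
      by (simp add: mult_ac)
    also have "\<dots> \<approx> x e * (?c * prod x (m - {e}))"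
    proof (rule cong_mult_left[OF x_R[OF eV]])
      have "B - e \<subseteq> V" "card (m - {e}) \<le> j + k" using "3.prems" cm by auto
      then show "edge_sum (m - {e}) ^ j * edge_sum (edges (B - e)) ^ k \<approx> ?c * prod x (m - {e})"
        using "3.hyps"[OF cm[symmetric] _ m'] cm by simp
    qed
    also have "\<dots> = ?c * prod x m"
      using e finm by (simp add: prod.remove mult_ac)
    finally show ?thesis by (simp add: mult_ac)
  qed
  have "edge_sum m ^ Suc j * edge_sum (edges B) ^ k =
      edge_sum m * (edge_sum m ^ j * edge_sum (edges B) ^ k)" by (simp add: mult_ac)
  also have "\<dots> = (\<Sum>e\<in>m. x e * (edge_sum m ^ j * edge_sum (edges B) ^ k))"
    unfolding edge_sum_def[of m] by (simp add: sum_distrib_right)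
  also have "\<dots> \<approx> (\<Sum>e\<in>m. ?c * prod x m)"
    using step by (rule cong_sum)
  also have "\<dots> = of_nat (matching_coeff (Suc j) k (card m)) * prod x m"
    by (simp add: mult_ac)
  finally show ?case .
qed

text \<open>
  Summing the relations at the vertices of \<open>A\<close> counts each edge inside \<open>A\<close> twice and each edge
  between \<open>A\<close> and \<open>V - A\<close> once. The latter also occur once in the sum over \<open>V - A\<close>, so they
  cancel in the difference.
\<close>
lemma edge_sum_complement:
  assumes "A \<subseteq> V"
  shows "edge_sum (edges A) \<approx> edge_sum (edges (V - A))"
proof -
  let ?B = "V - A" and ?E = "edges V"
  have finE: "finite ?E" using finite_edges[OF finite_V] .
  have star: "(\<Sum>v\<in>S. \<Sum>e\<in>{e \<in> ?E. v \<in> e}. x e) = (\<Sum>e\<in>?E. of_nat (card (e \<inter> S)) * x e)"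
    if "S \<subseteq> V" for S
  proof -
    have "(\<Sum>v\<in>S. \<Sum>e\<in>{e \<in> ?E. v \<in> e}. x e) = (\<Sum>e\<in>?E. \<Sum>v\<in>{v \<in> S. v \<in> e}. x e)"
      using finE finite_subset[OF that finite_V] by (intro sum.swap_restrict)
    moreover have "{v \<in> S. v \<in> e} = e \<inter> S" for e by auto
    ultimately show ?thesis by simp
  qed
  have inside: "edge_sum (edges S) = (\<Sum>e\<in>?E. if e \<subseteq> S then x e else 0)" if "S \<subseteq> V" for S
  proof -
    have "edges S = {e \<in> ?E. e \<subseteq> S}" using that by (auto simp: edges_def)
    then show ?thesis unfolding edge_sum_def using finE by (simp add: sum.inter_filter)
  qed
  let ?p = "edge_sum (edges A) - edge_sum (edges ?B)"
  have "(\<Sum>v\<in>A. \<Sum>e\<in>{e \<in> ?E. v \<in> e}. x e) + - (\<Sum>v\<in>?B. \<Sum>e\<in>{e \<in> ?E. v \<in> e}. x e) \<in> L"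
    using assms by (intro L_add L_minus L_sum L_star) auto
  also have "(\<Sum>v\<in>A. \<Sum>e\<in>{e \<in> ?E. v \<in> e}. x e) + - (\<Sum>v\<in>?B. \<Sum>e\<in>{e \<in> ?E. v \<in> e}. x e)
      = (\<Sum>e\<in>?E. (of_nat (card (e \<inter> A)) - of_nat (card (e \<inter> ?B))) * x e)"
    using star[OF assms] star[of ?B] by (simp add: left_diff_distrib sum_subtractf)
  also have "\<dots> = (\<Sum>e\<in>?E. ((if e \<subseteq> A then x e else 0) - (if e \<subseteq> ?B then x e else 0))
      + ((if e \<subseteq> A then x e else 0) - (if e \<subseteq> ?B then x e else 0)))"
  proof (rule sum.cong[OF refl])
    fix e assume "e \<in> ?E"
    then obtain i j where e: "e = {i, j}" "i \<noteq> j" "i \<in> V" "j \<in> V"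
      unfolding edges_def by (auto simp: card_2_iff)
    show "(of_nat (card (e \<inter> A)) - of_nat (card (e \<inter> ?B))) * x e =
      ((if e \<subseteq> A then x e else 0) - (if e \<subseteq> ?B then x e else 0))
      + ((if e \<subseteq> A then x e else 0) - (if e \<subseteq> ?B then x e else 0))"
      using e by (cases "i \<in> A"; cases "j \<in> A") (auto simp: algebra_simps)
  qed
  also have "\<dots> = ?p + ?p"
    using inside[OF assms] inside[OF Diff_subset] by (simp only: sum.distrib sum_subtractf)
  finally have "?p + ?p \<in> L" .
  moreover have R: "edge_sum (edges A) \<in> R" "edge_sum (edges ?B) \<in> R"
    using assms by (intro edge_sum_R edges_mono; auto)+
  moreover have "?p \<in> R" using R_add[OF R(1) R_minus[OF R(2)]] by simp
  ultimately show ?thesis unfolding cong_def using L_half by blast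
qed

text \<open>
  The sum over the perfect matchings of the complement of \<open>B\<close> becomes a power of
  \<open>edge_sum (edges (V - B))\<close>, which is replaced by a power of \<open>edge_sum (edges B)\<close>. Then
  \<open>matching_powers\<close> applies to each term of the binomial expansion.
\<close>
lemma sum_matching_powers_containing:
  assumes "card V = 2 * h" "B \<subseteq> V" "m \<in> perfect_matchings B" "card m \<le> d"
  shows "(\<Sum>P\<in>{P \<in> perfect_matchings V. m \<subseteq> P}. edge_sum P ^ d) \<approx>
         of_nat (containing_coeff h d (card m)) * prod x m"
proof -
  let ?A = "V - B" and ?r = "card m"
  have fin: "finite B" using assms(2) finite_V by (rule finite_subset)
  have finm: "finite m" using finite_perfect_matching[OF fin assms(3)] .
  have mV: "m \<subseteq> edges V" by (rule perfect_matching_edges_V[OF assms(2,3)])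
  have cA: "card ?A = 2 * (h - ?r)"
    using card_perfect_matching[OF fin assms(3)] assms(1,2) fin by (simp add: card_Diff_subset)
  have swap: "edge_sum (edges ?A) \<approx> edge_sum (edges B)"
    by (rule cong_sym[OF edge_sum_complement[OF assms(2)]])
  have "(\<Sum>P\<in>{P \<in> perfect_matchings V. m \<subseteq> P}. edge_sum P ^ d) =
        (\<Sum>Q\<in>perfect_matchings ?A. edge_sum (m \<union> Q) ^ d)"
    by (rule sum_perfect_matchings_containing[OF assms(3,2)])
  also have "\<dots> = (\<Sum>Q\<in>perfect_matchings ?A. (edge_sum Q + edge_sum m) ^ d)"
  proof (rule sum.cong[OF refl])
    fix Q assume Q: "Q \<in> perfect_matchings ?A"
    then have "finite Q" using finite_perfect_matching[OF finite_Diff[OF finite_V]] by blast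
    then have "edge_sum (m \<union> Q) = edge_sum Q + edge_sum m"
      unfolding edge_sum_def
      using perfect_matching_un(2)[OF assms(3) Q assms(2)] finm by (simp add: sum.union_disjoint)
    then show "edge_sum (m \<union> Q) ^ d = (edge_sum Q + edge_sum m) ^ d" by simp
  qed
  also have "\<dots> = (\<Sum>k\<le>d. of_nat (d choose k) * edge_sum m ^ (d - k) *
      (\<Sum>Q\<in>perfect_matchings ?A. edge_sum Q ^ k))"
    unfolding binomial_ring sum_distrib_left
    by (subst sum.swap) (simp add: mult_ac)
  also have "\<dots> \<approx> (\<Sum>k\<le>d. of_nat (d choose k) * edge_sum m ^ (d - k) *
      (of_nat (odd_fact (h - ?r - k)) * edge_sum (edges B) ^ k))"
    using mV swap
    by (intro cong_sum cong_mult_left cong_trans[OF sum_matching_powers[OF _ cA]] cong_power) auto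
  also have "\<dots> = (\<Sum>k\<le>d. of_nat ((d choose k) * odd_fact (h - ?r - k)) *
      (edge_sum m ^ (d - k) * edge_sum (edges B) ^ k))"
    by (simp add: mult_ac)
  also have "\<dots> \<approx> (\<Sum>k\<le>d. of_nat ((d choose k) * odd_fact (h - ?r - k)) *
      (of_nat (matching_coeff (d - k) k ?r) * prod x m))"
    using assms by (intro cong_sum cong_mult_left matching_powers) auto
  also have "\<dots> = of_nat (containing_coeff h d ?r) * prod x m"
    by (simp add: containing_coeff_def sum_distrib_right sum_distrib_left mult_ac)
  finally show ?thesis .
qed

end

section \<open>Evaluation and leading forms of polynomials\<close>

definition monom_eval :: "('v \<Rightarrow> complex) \<Rightarrow> ('v \<Rightarrow>\<^sub>0 nat) \<Rightarrow> complex" where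
  "monom_eval z m = (\<Prod>v\<in>Poly_Mapping.keys m. z v ^ Poly_Mapping.lookup m v)"

lemma monom_eval_superset:
  assumes "finite S" "Poly_Mapping.keys m \<subseteq> S"
  shows "monom_eval z m = (\<Prod>v\<in>S. z v ^ Poly_Mapping.lookup m v)"
  unfolding monom_eval_def
  using assms by (intro prod.mono_neutral_left) (auto simp: in_keys_iff)

lemma monom_eval_add: "monom_eval z (m + m') = monom_eval z m * monom_eval z m'"
proof -
  let ?S = "Poly_Mapping.keys m \<union> Poly_Mapping.keys m'"
  have "Poly_Mapping.keys (m + m') \<subseteq> ?S" by (rule Poly_Mapping.keys_add)
  then show ?thesis
    by (simp add: monom_eval_superset[of ?S] lookup_add power_add prod.distrib)
qed

lemma monom_eval_zero [simp]: "monom_eval z 0 = 1"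
  by (simp add: monom_eval_def)

lemma monom_eval_single [simp]: "monom_eval z (Poly_Mapping.single v (Suc 0)) = z v"
  by (simp add: monom_eval_def)

lemma poly_eval_cong:
  assumes "\<And>v. v \<in> vars p \<Longrightarrow> z v = z' v"
  shows "poly_eval z p = poly_eval z' p"
proof -
  have "z v = z' v" if "m \<in> Poly_Mapping.keys p" "v \<in> Poly_Mapping.keys m" for m v
    using assms that by (auto simp: vars_def)
  then show ?thesis unfolding poly_eval_def by (intro sum.cong prod.cong arg_cong2[of _ _ _ _ "(*)"]) auto
qed

lemma poly_eval_superset:
  assumes "finite S" "Poly_Mapping.keys p \<subseteq> S"
  shows "poly_eval z p = (\<Sum>m\<in>S. Poly_Mapping.lookup p m * monom_eval z m)"
  unfolding poly_eval_def monom_eval_def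
  using assms by (intro sum.mono_neutral_left) (auto simp: in_keys_iff)

lemma poly_eval_add [simp]: "poly_eval z (p + q) = poly_eval z p + poly_eval z q"
proof -
  let ?S = "Poly_Mapping.keys p \<union> Poly_Mapping.keys q"
  have "Poly_Mapping.keys (p + q) \<subseteq> ?S" by (rule Poly_Mapping.keys_add)
  then show ?thesis
    by (simp add: poly_eval_superset[of ?S] lookup_add distrib_right sum.distrib)
qed

lemma poly_eval_minus [simp]: "poly_eval z (- p) = - poly_eval z p"
  by (simp add: poly_eval_def sum_negf)

lemma poly_eval_diff [simp]: "poly_eval z (p - q) = poly_eval z p - poly_eval z q"
  using poly_eval_add[of z p "- q"] by simp

lemma poly_eval_zero [simp]: "poly_eval z 0 = 0"
  by (simp add: poly_eval_def)

lemma poly_eval_single [simp]: "poly_eval z (Poly_Mapping.single m c) = c * monom_eval z m"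
  using poly_eval_superset[of "{m}" "Poly_Mapping.single m c" z] by simp

lemma poly_eval_sum [simp]: "poly_eval z (sum f S) = (\<Sum>i\<in>S. poly_eval z (f i))"
  by (induction S rule: infinite_finite_induct) auto

lemma monom_degree_superset:
  assumes "finite S" "Poly_Mapping.keys m \<subseteq> S"
  shows "monom_degree m = (\<Sum>v\<in>S. Poly_Mapping.lookup m v)"
  unfolding monom_degree_def
  using assms by (intro sum.mono_neutral_left) (auto simp: in_keys_iff)

lemma monom_degree_add [simp]: "monom_degree (m + m') = monom_degree m + monom_degree m'"
proof -
  let ?S = "Poly_Mapping.keys m \<union> Poly_Mapping.keys m'"
  have "Poly_Mapping.keys (m + m') \<subseteq> ?S" by (rule Poly_Mapping.keys_add)
  then show ?thesis
    by (simp add: monom_degree_superset[of ?S] lookup_add sum.distrib)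
qed

lemma monom_degree_simps [simp]:
  "monom_degree 0 = 0" "monom_degree (Poly_Mapping.single v k) = k"
  by (auto simp: monom_degree_def)

lemma monom_degree_le_total_degree:
  "m \<in> Poly_Mapping.keys p \<Longrightarrow> monom_degree m \<le> total_degree p"
  unfolding total_degree_def by (intro Max_ge) auto

lemma lookup_hom_component:
  "Poly_Mapping.lookup (hom_component d p) m =
     (if monom_degree m = d then Poly_Mapping.lookup p m else 0)"
  unfolding hom_component_def
  by (auto simp: lookup_sum lookup_single when_def sum.delta in_keys_iff)

lemma vars_single: "vars (Poly_Mapping.single m c) \<subseteq> Poly_Mapping.keys m"
  by (auto simp: vars_def)

definition homogeneous :: "nat \<Rightarrow> 'v cpoly \<Rightarrow> bool" where
  "homogeneous d p \<longleftrightarrow> (\<forall>m\<in>Poly_Mapping.keys p. monom_degree m = d)"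

lemma homogeneous_single: "monom_degree m = d \<Longrightarrow> homogeneous d (Poly_Mapping.single m c)"
  by (simp add: homogeneous_def)

lemma homogeneous_add: "homogeneous d p \<Longrightarrow> homogeneous d q \<Longrightarrow> homogeneous d (p + q)"
  unfolding homogeneous_def using Poly_Mapping.keys_add[of p q] by blast

lemma homogeneous_diff: "homogeneous d p \<Longrightarrow> homogeneous d q \<Longrightarrow> homogeneous d (p - q)"
  using homogeneous_add[of d p "- q"] by (simp add: homogeneous_def)

lemma homogeneous_sum: "(\<And>i. i \<in> S \<Longrightarrow> homogeneous d (f i)) \<Longrightarrow> homogeneous d (sum f S)"
  by (induction S rule: infinite_finite_induct) (auto simp: homogeneous_add homogeneous_def[of d 0])

definition degree_below :: "nat \<Rightarrow> 'v cpoly \<Rightarrow> bool" where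
  "degree_below d p \<longleftrightarrow> (\<forall>m\<in>Poly_Mapping.keys p. monom_degree m < d)"

lemma degree_below_single: "monom_degree m < d \<Longrightarrow> degree_below d (Poly_Mapping.single m c)"
  by (simp add: degree_below_def)

lemma degree_below_add: "degree_below d p \<Longrightarrow> degree_below d q \<Longrightarrow> degree_below d (p + q)"
  unfolding degree_below_def using Poly_Mapping.keys_add[of p q] by blast

text \<open>
  Relations in the graded ideal are exhibited as a homogeneous polynomial together with a
  correction of lower degree that makes it vanish on \<open>Z\<close>.
\<close>
lemma leading_form_in_gr_ideal:
  assumes vars: "vars p \<subseteq> E" "vars q \<subseteq> E"
    and hom: "homogeneous d p" "degree_below d q"
    and vanish: "\<And>z. z \<in> Z \<Longrightarrow> poly_eval z p + poly_eval z q = 0"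
  shows "p \<in> gr_ideal E Z"
proof (cases "p = 0")
  case True
  interpret ideal "gr_ideal E Z" "poly_ring E" by (rule ideal_gr_ideal)
  show ?thesis using additive_subgroup.zero_closed[OF is_additive_subgroup] True by simp
next
  case False
  interpret cring "poly_ring E" by (rule cring_poly_ring)
  let ?f = "p + q"
  have q0: "Poly_Mapping.lookup q m = 0" if "monom_degree m \<ge> d" for m
    using that hom(2) unfolding degree_below_def by (metis in_keys_iff leD)
  have p0: "Poly_Mapping.lookup p m = 0" if "monom_degree m \<noteq> d" for m
    using that hom(1) unfolding homogeneous_def by (metis in_keys_iff)
  obtain m where m: "m \<in> Poly_Mapping.keys p" using False by fastforce
  then have md: "monom_degree m = d" using hom by (simp add: homogeneous_def)
  have mf: "m \<in> Poly_Mapping.keys ?f" using m q0[of m] md by (simp add: in_keys_iff lookup_add)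
  have "monom_degree m' \<le> d" if "m' \<in> Poly_Mapping.keys ?f" for m'
    using that q0[of m'] p0[of m'] by (cases "monom_degree m' \<le> d") (auto simp: in_keys_iff lookup_add)
  then have td: "total_degree ?f = d"
    unfolding total_degree_def using mf md by (intro Max_eqI) auto
  have "top_component ?f = p"
    unfolding top_component_def td
    by (rule poly_mapping_eqI) (auto simp: lookup_hom_component lookup_add q0 p0)
  moreover have "?f \<in> vanishing_ideal E Z"
    using vars vanish vars_add[of p q] by (auto simp: vanishing_ideal_def)
  moreover have "?f \<noteq> 0" using mf by auto
  ultimately have "p \<in> top_component ` {f \<in> vanishing_ideal E Z. f \<noteq> 0}" by force
  moreover have "top_component ` {f \<in> vanishing_ideal E Z. f \<noteq> 0} \<subseteq> carrier (poly_ring E)"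
    using hom_component_vars by (fastforce simp: top_component_def vanishing_ideal_def)
  ultimately show ?thesis
    unfolding gr_ideal_def using genideal_self by blast
qed

definition var :: "'v \<Rightarrow> 'v cpoly" where
  "var v = Poly_Mapping.single (Poly_Mapping.single v 1) 1"

lemma vars_var: "vars (var v) \<subseteq> {v}"
  by (auto simp: var_def vars_def)

lemma homogeneous_var: "homogeneous 1 (var v)"
  by (simp add: var_def homogeneous_single)

lemma homogeneous_var_mult: "homogeneous 2 (var v * var w)"
  by (simp add: var_def mult_single homogeneous_single)

lemma poly_eval_var [simp]: "poly_eval z (var v) = z v"
  by (simp add: var_def)

lemma poly_eval_var_mult [simp]: "poly_eval z (var v * var w) = z v * z w"
  by (simp add: var_def mult_single monom_eval_add)

abbreviation const :: "complex \<Rightarrow> 'v cpoly" where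
  "const c \<equiv> Poly_Mapping.single 0 c"

lemma vars_const [simp]: "vars (const c) = {}"
  using vars_single[of 0 c] by simp

lemma const_mult_single: "const c * Poly_Mapping.single m b = Poly_Mapping.single m (c * b)"
  by (simp add: mult_single)

lemma const_sum: "const (sum f S) = (\<Sum>i\<in>S. const (f i))"
  by (induction S rule: infinite_finite_induct) (simp_all add: single_add)

lemma of_nat_eq_const: "(of_nat k :: 'v cpoly) = const (of_nat k)"
  by (induction k) (simp_all add: single_add single_one)

lemma const_mult_of_nat_mult_single:
  "const b * (of_nat k * Poly_Mapping.single m 1) = of_nat k * Poly_Mapping.single m b"
  unfolding of_nat_eq_const const_mult_single by (simp only: mult_1_right mult.commute[of b])

lemma prod_var:
  assumes "finite S"
  shows "prod var S = Poly_Mapping.single (\<Sum>v\<in>S. Poly_Mapping.single v 1) 1"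
  using assms by (induction S) (simp_all add: var_def mult_single)

lemma squarefree_monomial_eq_prod_var:
  assumes "\<And>v. v \<in> Poly_Mapping.keys m \<Longrightarrow> Poly_Mapping.lookup m v = 1"
  shows "Poly_Mapping.single m 1 = prod var (Poly_Mapping.keys m)"
proof -
  have "m = (\<Sum>v\<in>Poly_Mapping.keys m. Poly_Mapping.single v 1)"
    using assms
    by (intro poly_mapping_eqI) (auto simp: lookup_sum lookup_single when_def sum.delta in_keys_iff)
  then show ?thesis by (simp add: prod_var)
qed

lemma monom_degree_ge_card: "card (Poly_Mapping.keys m) \<le> monom_degree m"
proof -
  have "(\<Sum>v\<in>Poly_Mapping.keys m. 1) \<le> (\<Sum>v\<in>Poly_Mapping.keys m. Poly_Mapping.lookup m v)"
    by (intro sum_mono) (simp add: in_keys_iff Suc_le_eq)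
  then show ?thesis by (simp add: monom_degree_def)
qed

lemma squarefree_if_degree_le_card:
  assumes "monom_degree m \<le> card (Poly_Mapping.keys m)" "v \<in> Poly_Mapping.keys m"
  shows "Poly_Mapping.lookup m v = 1"
proof (rule ccontr)
  assume "Poly_Mapping.lookup m v \<noteq> 1"
  then have "1 < Poly_Mapping.lookup m v"
    using assms(2) by (simp add: in_keys_iff)
  moreover have "1 \<le> Poly_Mapping.lookup m w" if "w \<in> Poly_Mapping.keys m" for w
    using that by (simp add: in_keys_iff Suc_le_eq)
  ultimately have "(\<Sum>v\<in>Poly_Mapping.keys m. 1) < (\<Sum>v\<in>Poly_Mapping.keys m. Poly_Mapping.lookup m v)"
    using assms(2) by (intro sum_strict_mono_ex1) auto
  then show False using assms(1) by (simp add: monom_degree_def)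
qed

lemma monom_eval_indicator:
  "monom_eval (\<lambda>v. if v \<in> S then 1 else 0) m = (if Poly_Mapping.keys m \<subseteq> S then 1 else 0)"
proof (cases "Poly_Mapping.keys m \<subseteq> S")
  case False
  then obtain v where "v \<in> Poly_Mapping.keys m" "v \<notin> S" by blast
  then have "\<exists>v\<in>Poly_Mapping.keys m. (if v \<in> S then 1 else 0 :: complex) ^ Poly_Mapping.lookup m v = 0"
    by (intro bexI[of _ v]) (auto simp: in_keys_iff)
  then show ?thesis unfolding monom_eval_def using False by (simp add: prod_zero)
qed (auto simp: monom_eval_def subset_iff intro!: prod.neutral)

section \<open>Polynomials vanishing on the perfect matchings\<close>

text \<open>
  The relations rule out every monomial that is not squarefree or whose support is not a matching.
  The remaining ones are compared with the sums of the previous section.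
\<close>
locale polynomial_matching_relations =
  matching_relations "carrier (poly_ring (edges V))" L V var
  for V :: "'v set" and L :: "'v set cpoly set"
begin

abbreviation poly_cong (infix "\<approx>" 50) where
  "p \<approx> q \<equiv> cong p q"

lemma single_in_ideal_if_factor:
  assumes "m = m' + (Poly_Mapping.single e 1 + Poly_Mapping.single e' 1)"
    and "Poly_Mapping.keys m \<subseteq> edges V" "e \<inter> e' \<noteq> {}"
  shows "Poly_Mapping.single m 1 \<in> L"
proof -
  have "e \<in> Poly_Mapping.keys m" "e' \<in> Poly_Mapping.keys m"
    unfolding assms(1) by (auto simp: in_keys_iff lookup_add lookup_single when_def)
  moreover have "Poly_Mapping.keys m' \<subseteq> Poly_Mapping.keys m"
    unfolding assms(1) by (auto simp: in_keys_iff lookup_add)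
  ultimately have "e \<in> edges V" "e' \<in> edges V" "Poly_Mapping.keys m' \<subseteq> edges V"
    using assms(2) by auto
  then have "Poly_Mapping.single m' 1 * (var e * var e') \<in> L"
    using vars_single[of m' 1] L_meeting[OF _ _ assms(3)] by (intro L_mult[of "Poly_Mapping.single m' 1"]) auto
  then show ?thesis by (simp add: var_def mult_single assms(1))
qed

lemma single_in_ideal_if_not_squarefree:
  assumes "Poly_Mapping.keys m \<subseteq> edges V" "Poly_Mapping.lookup m e \<ge> 2"
  shows "Poly_Mapping.single m 1 \<in> L"
proof (rule single_in_ideal_if_factor[OF _ assms(1)])
  show "m = (m - Poly_Mapping.single e 2) + (Poly_Mapping.single e 1 + Poly_Mapping.single e 1)"
    using assms(2)
    by (intro poly_mapping_eqI) (auto simp: lookup_add lookup_minus lookup_single when_def)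
  have "e \<in> edges V" using assms by (auto simp: in_keys_iff)
  then show "e \<inter> e \<noteq> {}" by (auto simp: edges_def)
qed

lemma single_in_ideal_if_not_disjoint:
  assumes "Poly_Mapping.keys m \<subseteq> edges V" "\<not> disjoint (Poly_Mapping.keys m)"
  shows "Poly_Mapping.single m 1 \<in> L"
proof -
  obtain e e' where e: "e \<in> Poly_Mapping.keys m" "e' \<in> Poly_Mapping.keys m" "e \<noteq> e'" "e \<inter> e' \<noteq> {}"
    using assms(2) by (auto simp: disjoint_def)
  have "m = (m - (Poly_Mapping.single e 1 + Poly_Mapping.single e' 1))
      + (Poly_Mapping.single e 1 + Poly_Mapping.single e' 1)"
    using e
    by (intro poly_mapping_eqI)
      (auto simp: lookup_add lookup_minus lookup_single when_def in_keys_iff)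
  then show ?thesis by (rule single_in_ideal_if_factor[OF _ assms(1) e(4)])
qed

text \<open>
  Three cases: the support is not a matching, and then no perfect matching contains it; it is a
  matching with fewer than \<open>d\<close> edges, and then the coefficient vanishes, while a monomial of
  degree \<open>d\<close> with that support has a repeated factor; or it is a matching with \<open>d\<close> edges, which
  forces the monomial to be squarefree of degree \<open>d\<close>.
\<close>
lemma sum_matching_powers_containing_monomial:
  assumes V: "card V = 2 * h"
    and m: "Poly_Mapping.keys m \<subseteq> edges V" "monom_degree m \<le> d"
  shows "(\<Sum>P\<in>{P \<in> perfect_matchings V. Poly_Mapping.keys m \<subseteq> P}. edge_sum P ^ d) \<approx>
    (if monom_degree m = d
     then of_nat (containing_coeff h d d) * Poly_Mapping.single m 1 else 0)"
proof -
  let ?K = "Poly_Mapping.keys m" and ?c = "of_nat (containing_coeff h d d) :: 'v set cpoly"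
  let ?S = "\<Sum>P\<in>{P \<in> perfect_matchings V. ?K \<subseteq> P}. edge_sum P ^ d"
  have zero: ?thesis if S: "?S \<in> L" and m1: "monom_degree m = d \<Longrightarrow> Poly_Mapping.single m 1 \<in> L"
  proof -
    have "?S \<approx> 0" using S by (simp add: cong_zero_iff)
    moreover have "?c * Poly_Mapping.single m 1 \<in> L" if "monom_degree m = d"
      using m1[OF that] by (intro L_mult) (rule R_of_nat)
    then have "0 \<approx> ?c * Poly_Mapping.single m 1" if "monom_degree m = d"
      using that cong_zero_iff cong_sym by blast
    ultimately show ?thesis using cong_trans by (auto split: if_splits)
  qed
  show ?thesis
  proof (cases "disjoint ?K")
    case False
    have "\<not> ?K \<subseteq> P" if "P \<in> perfect_matchings V" for P
      using that False perfect_matching_subset perfect_matching_iff by blast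
    then have "{P \<in> perfect_matchings V. ?K \<subseteq> P} = {}" by blast
    then have "?S \<in> L" by (metis sum.empty L_zero)
    then show ?thesis using zero single_in_ideal_if_not_disjoint[OF m(1) False] by blast
  next
    case True
    then have K: "?K \<in> perfect_matchings (\<Union>?K)" "\<Union>?K \<subseteq> V"
      using m(1) by (auto simp: perfect_matching_iff edges_def)
    have le: "card ?K \<le> d" using monom_degree_ge_card[of m] m(2) by simp
    have S: "?S \<approx> of_nat (containing_coeff h d (card ?K)) * prod var ?K"
      using sum_matching_powers_containing[OF V K(2,1) le].
    show ?thesis
    proof (cases "card ?K = d")
      case True
      then have md: "monom_degree m = d" using monom_degree_ge_card[of m] m(2) by simp
      have "Poly_Mapping.single m 1 = prod var ?K"
        using squarefree_monomial_eq_prod_var[of m] squarefree_if_degree_le_card[of m] md True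
        by simp
      then show ?thesis using S md True by simp
    next
      case False
      then have lt: "card ?K < d" using le by simp
      then have "?S \<in> L" using S by (simp add: containing_coeff_eq_0 cong_zero_iff)
      moreover have "Poly_Mapping.single m 1 \<in> L" if "monom_degree m = d"
      proof -
        have "\<exists>e. 2 \<le> Poly_Mapping.lookup m e"
        proof (rule ccontr)
          assume "\<not> (\<exists>e. 2 \<le> Poly_Mapping.lookup m e)"
          then have "Poly_Mapping.lookup m e \<le> 1" for e by (metis not_less_eq_eq numeral_2_eq_2 One_nat_def)
          then have "monom_degree m \<le> (\<Sum>e\<in>?K. 1)"
            unfolding monom_degree_def by (intro sum_mono)
          then show False using that lt by simp
        qed
        then show ?thesis using single_in_ideal_if_not_squarefree[OF m(1)] by blast
      qed
      ultimately show ?thesis by (rule zero)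
    qed
  qed
qed

text \<open>
  Multiplying the value of \<open>f\<close> at \<open>P\<close>, which is zero, by \<open>edge_sum P ^ d\<close> and summing over \<open>P\<close>
  leaves only the terms of degree \<open>d\<close>, all with the same positive factor.
\<close>
lemma top_component_in_ideal:
  assumes V: "card V = 2 * h" and f: "vars f \<subseteq> edges V"
    and vanish: "\<And>P. P \<in> perfect_matchings V \<Longrightarrow> poly_eval (\<lambda>e. if e \<in> P then 1 else 0) f = 0"
  shows "top_component f \<in> L"
proof -
  define d where "d = total_degree f"
  define c where "c = containing_coeff h d d"
  let ?K = "Poly_Mapping.keys f" and ?M = "perfect_matchings V"
  let ?coeff = "\<lambda>m. const (Poly_Mapping.lookup f m) :: 'v set cpoly"
  have keys: "Poly_Mapping.keys m \<subseteq> edges V" if "m \<in> ?K" for m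
    using that f by (auto simp: vars_def)
  have eval: "(\<Sum>m\<in>?K. if Poly_Mapping.keys m \<subseteq> P then ?coeff m else 0) = 0" if P: "P \<in> ?M" for P
  proof -
    have "(\<Sum>m\<in>?K. if Poly_Mapping.keys m \<subseteq> P then ?coeff m else 0) =
        const (\<Sum>m\<in>?K. Poly_Mapping.lookup f m * (if Poly_Mapping.keys m \<subseteq> P then 1 else 0))"
      unfolding const_sum by (intro sum.cong refl) simp
    also have "\<dots> = const (poly_eval (\<lambda>e. if e \<in> P then 1 else 0) f)"
      unfolding poly_eval_def monom_eval_def[symmetric] monom_eval_indicator ..
    finally show ?thesis using vanish[OF P] by simp
  qed
  have "0 = (\<Sum>P\<in>?M. (\<Sum>m\<in>?K. if Poly_Mapping.keys m \<subseteq> P then ?coeff m else 0) * edge_sum P ^ d)"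
    using eval by simp
  also have "\<dots> = (\<Sum>m\<in>?K. \<Sum>P\<in>?M. if Poly_Mapping.keys m \<subseteq> P then ?coeff m * edge_sum P ^ d else 0)"
    unfolding sum_distrib_right by (subst sum.swap) (intro sum.cong refl, simp)
  also have "\<dots> = (\<Sum>m\<in>?K. ?coeff m * (\<Sum>P\<in>{P \<in> ?M. Poly_Mapping.keys m \<subseteq> P}. edge_sum P ^ d))"
    unfolding sum_distrib_left using finite_perfect_matchings[OF finite_V]
    by (simp add: sum.inter_filter)
  also have "\<dots> \<approx> (\<Sum>m\<in>?K. ?coeff m *
      (if monom_degree m = d then of_nat c * Poly_Mapping.single m 1 else 0))"
    unfolding c_def
  proof (rule cong_sum, rule cong_mult_left)
    fix m assume m: "m \<in> ?K"
    show "?coeff m \<in> carrier (poly_ring (edges V))" by simp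
    show "(\<Sum>P\<in>{P \<in> ?M. Poly_Mapping.keys m \<subseteq> P}. edge_sum P ^ d) \<approx>
      (if monom_degree m = d
       then of_nat (containing_coeff h d d) * Poly_Mapping.single m 1 else 0)"
      using m unfolding d_def
      by (intro sum_matching_powers_containing_monomial V keys monom_degree_le_total_degree)
  qed
  also have "\<dots> = (\<Sum>m\<in>?K. if monom_degree m = d
      then of_nat c * Poly_Mapping.single m (Poly_Mapping.lookup f m) else 0)"
    by (intro sum.cong refl) (simp add: const_mult_of_nat_mult_single)
  also have "\<dots> = of_nat c * hom_component d f"
    unfolding hom_component_def sum_distrib_left by (simp add: sum.inter_filter)
  finally have "of_nat c * top_component f \<in> L"
    using cong_sym cong_zero_iff unfolding top_component_def d_def by blast
  then have "const (1 / of_nat c) * (of_nat c * top_component f) \<in> L"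
    by (rule L_mult[rotated]) simp
  moreover have "const (1 / of_nat c) * (of_nat c * top_component f) = top_component f"
    using containing_coeff_pos[of h d]
    unfolding of_nat_eq_const mult.assoc[symmetric] const_mult_single by (simp add: c_def)
  ultimately show ?thesis by simp
qed

end

section \<open>Leading forms of relations on bipartitions\<close>

lemma pairs_eq_edges: "pairs n = edges {1..n}"
  by (simp add: pairs_def edges_def)

lemma bipartition_point_cases:
  assumes "z \<in> partition_points n (replicate_mset 2 a)"
  obtains X where "X \<subseteq> {1..n}" "card X = a" "card ({1..n} - X) = a"
    "\<And>i j. i \<in> {1..n} \<Longrightarrow> j \<in> {1..n} \<Longrightarrow> i \<noteq> j \<Longrightarrow>
       z {i, j} = (if i \<in> X \<longleftrightarrow> j \<in> X then 1 else 0)"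
proof -
  obtain P where P: "partition_on {1..n} P" "image_mset card (mset_set P) = replicate_mset 2 a"
    and z: "z = partition_point n P"
    using assms unfolding partition_points_def by auto
  have "finite P" using P(1) by (rule finite_elements[OF finite_atLeastAtMost])
  then have cards: "card B = a" if "B \<in> P" for B
    using that P(2) by (metis finite_set_mset_mset_set image_eqI in_replicate_mset set_image_mset)
  have "card P = 2" using arg_cong[OF P(2), of size] by simp
  then obtain X Y where XY: "P = {X, Y}" "X \<noteq> Y" by (auto simp: card_2_iff)
  have un: "X \<union> Y = {1..n}" using partition_onD1[OF P(1)] XY by auto
  have "X \<inter> Y = {}" using partition_onD2[OF P(1)] XY by (auto dest: disjointD)
  then have Y: "Y = {1..n} - X" using un by auto
  show thesis
  proof (rule that)
    show "X \<subseteq> {1..n}" "card X = a" "card ({1..n} - X) = a"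
      using un cards[of X] cards[of Y] XY Y by auto
    fix i j assume ij: "i \<in> {1..n}" "j \<in> {1..n}" "i \<noteq> j"
    then have "{i, j} \<in> pairs n" by (simp add: pairs_def)
    then show "z {i, j} = (if i \<in> X \<longleftrightarrow> j \<in> X then 1 else 0)"
      using ij Y unfolding z partition_point_def XY by auto
  qed
qed

lemma sum_star_bipartition_point:
  assumes "z \<in> partition_points n (replicate_mset 2 a)" "v \<in> {1..n}"
  shows "(\<Sum>e\<in>{e \<in> pairs n. v \<in> e}. z e) = of_nat a - 1"
proof -
  obtain X where X: "X \<subseteq> {1..n}" "card X = a" "card ({1..n} - X) = a"
    and z: "\<And>i j. i \<in> {1..n} \<Longrightarrow> j \<in> {1..n} \<Longrightarrow> i \<noteq> j \<Longrightarrow>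
       z {i, j} = (if i \<in> X \<longleftrightarrow> j \<in> X then 1 else 0)"
    using bipartition_point_cases[OF assms(1)] by blast
  define Y where "Y = (if v \<in> X then X else {1..n} - X)"
  have Y: "v \<in> Y" "Y \<subseteq> {1..n}" "card Y = a" "\<And>w. w \<in> {1..n} \<Longrightarrow> (v \<in> X \<longleftrightarrow> w \<in> X) \<longleftrightarrow> w \<in> Y"
    using X assms(2) by (auto simp: Y_def)
  have finY: "finite Y" using Y(2) finite_subset by blast
  have "{e \<in> pairs n. v \<in> e} = (\<lambda>w. {v, w}) ` ({1..n} - {v})"
  proof
    show "{e \<in> pairs n. v \<in> e} \<subseteq> (\<lambda>w. {v, w}) ` ({1..n} - {v})"
      by (auto simp: pairs_def card_2_iff)
    show "(\<lambda>w. {v, w}) ` ({1..n} - {v}) \<subseteq> {e \<in> pairs n. v \<in> e}"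
      using assms(2) by (auto simp: pairs_def)
  qed
  moreover have "inj_on (\<lambda>w. {v, w}) ({1..n} - {v})"
    by (auto simp: inj_on_def doubleton_eq_iff)
  ultimately have "(\<Sum>e\<in>{e \<in> pairs n. v \<in> e}. z e) = (\<Sum>w\<in>{1..n} - {v}. z {v, w})"
    by (simp add: sum.reindex)
  also have "\<dots> = (\<Sum>w\<in>{1..n} - {v}. if w \<in> Y then 1 else 0)"
  proof (rule sum.cong[OF refl])
    fix w assume "w \<in> {1..n} - {v}"
    then show "z {v, w} = (if w \<in> Y then 1 else 0)"
      using z[of v w] assms(2) Y(4)[of w] by auto
  qed
  also have "\<dots> = of_nat (card (Y - {v}))"
  proof -
    have "({1..n} - {v}) \<inter> Y = Y - {v}" using Y(2) by auto
    then show ?thesis by (simp add: sum.If_cases Int_def[symmetric] Collect_mem_eq)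
  qed
  also have "\<dots> = of_nat a - 1"
  proof -
    have "Suc (card (Y - {v})) = a" using Y(1,3) finY by (metis card_Suc_Diff1)
    then show ?thesis by (metis add_diff_cancel_left' of_nat_Suc)
  qed
  finally show ?thesis .
qed

lemma subring_ideal_gr: "subring_ideal (carrier (poly_ring E)) (gr_ideal E Z)"
proof -
  interpret ideal "gr_ideal E Z" "poly_ring E" by (rule ideal_gr_ideal)
  note add_closed = additive_subgroup.a_subgroup[OF is_additive_subgroup]
  show ?thesis
  proof
    fix p q :: "'a cpoly"
    show "p + q \<in> carrier (poly_ring E)"
      if "p \<in> carrier (poly_ring E)" "q \<in> carrier (poly_ring E)"
      using that vars_add[of p q] by auto
    show "p * q \<in> carrier (poly_ring E)"
      if "p \<in> carrier (poly_ring E)" "q \<in> carrier (poly_ring E)"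
      using that vars_mult[of p q] by auto
    show "p + q \<in> gr_ideal E Z" if "p \<in> gr_ideal E Z" "q \<in> gr_ideal E Z"
      using subgroup.m_closed[OF add_closed that] by (simp add: poly_ring_def)
    show "p * q \<in> gr_ideal E Z" if "p \<in> carrier (poly_ring E)" "q \<in> gr_ideal E Z"
      using I_l_closed[OF that(2,1)] by simp
  qed (use additive_subgroup.zero_closed[OF is_additive_subgroup]
      additive_subgroup.a_subset[OF is_additive_subgroup] in auto)
qed

text \<open>
  The correction terms of lower degree come from \<open>z {i, j} = (1 + s i * s j) / 2\<close> with signs
  \<open>s i\<close>. For instance, \<open>z {i, j} * z {i, k}\<close> equals half of
  \<open>z {i, j} + z {i, k} + z {j, k} - 1\<close>, because \<open>s i\<close> cancels in the product of \<open>s i * s j\<close> and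
  \<open>s i * s k\<close>; and the products in the swap relation both contain \<open>s i * s j * s k * s l\<close>.
\<close>
lemma matching_relations_gr_bipartitions:
  "matching_relations (carrier (poly_ring (pairs n)))
     (gr_ideal (pairs n) (partition_points n (replicate_mset 2 a))) {1..n} var"
proof -
  define E where "E = pairs n"
  define Z where "Z = partition_points n (replicate_mset 2 a)"
  interpret subring_ideal "carrier (poly_ring E)" "gr_ideal E Z" by (rule subring_ideal_gr)
  have var_R: "var e \<in> carrier (poly_ring E)" if "e \<in> E" for e
    using that vars_var[of e] by auto
  have const_R: "const c \<in> carrier (poly_ring E)" for c by simp
  have half: "p \<in> gr_ideal E Z" if "p + p \<in> gr_ideal E Z" for p
  proof -
    have "const (1/2) * (p + p) = (const (1/2) + const (1/2)) * p"
      by (simp add: distrib_left distrib_right)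
    also have "\<dots> = p" by (simp add: single_add[symmetric] single_one)
    finally show ?thesis using L_mult[OF const_R that] by metis
  qed
  have linear: "const c * var e \<in> carrier (poly_ring E)" "degree_below 2 (const c * var e)"
    "poly_eval z (const c * var e) = c * z e" if "e \<in> E" for c e z
    using R_mult[OF const_R var_R[OF that]]
    by (simp_all add: var_def const_mult_single degree_below_single)
  have lead: "p \<in> gr_ideal E Z"
    if "p \<in> carrier (poly_ring E)" "q \<in> carrier (poly_ring E)" "homogeneous d p" "degree_below d q"
      "\<And>z. z \<in> Z \<Longrightarrow> poly_eval z p + poly_eval z q = 0" for p q d
    using that by (intro leading_form_in_gr_ideal) simp_all
  have square: "var e * var e \<in> gr_ideal E Z" if e: "e \<in> E" for e
  proof (rule lead)
    show "const (- 1) * var e \<in> carrier (poly_ring E)" "degree_below 2 (const (- 1) * var e)"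
      using linear[OF e] by blast+
    show "var e * var e \<in> carrier (poly_ring E)" using e var_R by (intro R_mult)
    show "homogeneous 2 (var e * var e)" by (rule homogeneous_var_mult)
    fix z assume "z \<in> Z"
    moreover obtain i j where "e = {i, j}" "i \<noteq> j" "i \<in> {1..n}" "j \<in> {1..n}"
      using e unfolding E_def pairs_def by (auto simp: card_2_iff)
    ultimately obtain X where "z e = (if i \<in> X \<longleftrightarrow> j \<in> X then 1 else 0)"
      using bipartition_point_cases unfolding Z_def by metis
    then show "poly_eval z (var e * var e) + poly_eval z (const (- 1) * var e) = 0"
      using linear(3)[OF e] by simp
  qed
  have adjacent: "var {i, j} * var {i, k} \<in> gr_ideal E Z"
    if n: "i \<in> {1..n}" "j \<in> {1..n}" "k \<in> {1..n}" and ne: "i \<noteq> j" "i \<noteq> k" "j \<noteq> k" for i j k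
  proof (rule lead)
    let ?q = "const (- 1/2) * var {i, j} + const (- 1/2) * var {i, k} + const (- 1/2) * var {j, k}
      + const (1/2)"
    have e: "{i, j} \<in> E" "{i, k} \<in> E" "{j, k} \<in> E" using n ne by (auto simp: E_def pairs_def)
    show "var {i, j} * var {i, k} \<in> carrier (poly_ring E)" using e var_R by (intro R_mult)
    show "?q \<in> carrier (poly_ring E)" using e linear const_R by (intro R_add) blast+
    show "homogeneous 2 (var {i, j} * var {i, k})" by (rule homogeneous_var_mult)
    show "degree_below 2 ?q"
      using e linear by (intro degree_below_add degree_below_single) (blast | simp)+
    fix z assume "z \<in> Z"
    then obtain X where "\<And>i j. i \<in> {1..n} \<Longrightarrow> j \<in> {1..n} \<Longrightarrow> i \<noteq> j \<Longrightarrow>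
       z {i, j} = (if i \<in> X \<longleftrightarrow> j \<in> X then 1 else 0)"
      using bipartition_point_cases unfolding Z_def by metis
    then have "z {i, j} = (if i \<in> X \<longleftrightarrow> j \<in> X then 1 else 0)"
      "z {i, k} = (if i \<in> X \<longleftrightarrow> k \<in> X then 1 else 0)"
      "z {j, k} = (if j \<in> X \<longleftrightarrow> k \<in> X then 1 else 0)"
      using n ne by blast+
    then show "poly_eval z (var {i, j} * var {i, k}) + poly_eval z ?q = 0"
      by (simp add: linear(3) e)
  qed
  have swap: "var {i, j} * var {k, l} - var {i, k} * var {j, l} \<in> gr_ideal E Z"
    if n: "{i, j, k, l} \<subseteq> {1..n}" and four: "card {i, j, k, l} = 4" for i j k l
  proof (rule lead)
    let ?p = "var {i, j} * var {k, l} - var {i, k} * var {j, l}"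
    let ?q = "const (- 1/2) * var {i, j} + const (- 1/2) * var {k, l}
      + const (1/2) * var {i, k} + const (1/2) * var {j, l}"
    have ne: "i \<noteq> j" "i \<noteq> k" "i \<noteq> l" "j \<noteq> k" "j \<noteq> l" "k \<noteq> l"
      using four by (auto simp: card_insert_if split: if_splits)
    have e: "{i, j} \<in> E" "{k, l} \<in> E" "{i, k} \<in> E" "{j, l} \<in> E"
      using n ne by (auto simp: E_def pairs_def)
    show "?p \<in> carrier (poly_ring E)"
      using R_add[OF R_mult[OF var_R var_R] R_minus[OF R_mult[OF var_R var_R]],
          OF e(1,2,3,4)] by simp
    show "?q \<in> carrier (poly_ring E)" using e linear by (intro R_add) blast+
    show "homogeneous 2 ?p" by (intro homogeneous_diff homogeneous_var_mult)
    show "degree_below 2 ?q" using e linear by (intro degree_below_add) blast+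
    fix z assume "z \<in> Z"
    then obtain X where "\<And>i j. i \<in> {1..n} \<Longrightarrow> j \<in> {1..n} \<Longrightarrow> i \<noteq> j \<Longrightarrow>
       z {i, j} = (if i \<in> X \<longleftrightarrow> j \<in> X then 1 else 0)"
      using bipartition_point_cases unfolding Z_def by metis
    then have "z {i, j} = (if i \<in> X \<longleftrightarrow> j \<in> X then 1 else 0)"
      "z {k, l} = (if k \<in> X \<longleftrightarrow> l \<in> X then 1 else 0)"
      "z {i, k} = (if i \<in> X \<longleftrightarrow> k \<in> X then 1 else 0)"
      "z {j, l} = (if j \<in> X \<longleftrightarrow> l \<in> X then 1 else 0)"
      using n ne by simp_all
    then show "poly_eval z ?p + poly_eval z ?q = 0"
      by (simp add: linear(3) e)
  qed
  have star: "(\<Sum>e\<in>{e \<in> E. v \<in> e}. var e) \<in> gr_ideal E Z" if v: "v \<in> {1..n}" for v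
  proof (rule lead)
    let ?p = "\<Sum>e\<in>{e \<in> E. v \<in> e}. var e"
    let ?q = "const (1 - of_nat a)"
    show "?p \<in> carrier (poly_ring E)" using var_R by (intro R_sum) blast
    show "?q \<in> carrier (poly_ring E)" by (rule const_R)
    show "homogeneous 1 ?p" by (intro homogeneous_sum homogeneous_var)
    show "degree_below 1 ?q" by (rule degree_below_single) simp
    show "poly_eval z ?p + poly_eval z ?q = 0" if "z \<in> Z" for z
      using sum_star_bipartition_point[of z n a v] that v by (simp add: E_def Z_def)
  qed
  have meeting: "var e * var e' \<in> gr_ideal E Z" if e: "e \<in> E" "e' \<in> E" "e \<inter> e' \<noteq> {}" for e e'
  proof (cases "e = e'")
    case True
    then show ?thesis using square e by blast
  next
    case False
    obtain i where i: "i \<in> e" "i \<in> e'" using e by blast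
    have "\<exists>j. b = {i, j} \<and> j \<noteq> i" if "b \<in> E" "i \<in> b" for b
      using that unfolding E_def pairs_def by (auto simp: card_2_iff)
    then obtain j k where jk: "e = {i, j}" "j \<noteq> i" "e' = {i, k}" "k \<noteq> i" using e i by metis
    moreover have "i \<in> {1..n}" "j \<in> {1..n}" "k \<in> {1..n}"
      using e jk unfolding E_def pairs_def by auto
    ultimately show ?thesis using adjacent[of i j k] False by blast
  qed
  show ?thesis
    unfolding E_def[symmetric] Z_def[symmetric]
  proof (intro matching_relations.intro matching_relations_axioms.intro,
      unfold pairs_eq_edges[symmetric] E_def[symmetric])
    show "subring_ideal (carrier (poly_ring E)) (gr_ideal E Z)" by (rule subring_ideal_gr)
    show "finite {1..n}" by simp
  qed (fact var_R meeting star swap | rule half, assumption)+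
qed

lemma perfect_matching_point:
  assumes "P \<in> perfect_matchings {1..2 * a}"
  shows "partition_point (2 * a) P \<in> partition_points (2 * a) (replicate_mset a 2)"
proof -
  have P: "partition_on {1..2 * a} P" "\<And>e. e \<in> P \<Longrightarrow> card e = 2"
    using assms by (auto simp: perfect_matchings_def)
  have fin: "finite P" using finite_perfect_matching[OF _ assms] by simp
  have "image_mset card (mset_set P) = image_mset (\<lambda>_. 2) (mset_set P)"
    using P(2) fin by (intro image_mset_cong) simp
  also have "\<dots> = replicate_mset a 2"
    using card_perfect_matching[OF _ assms] by (simp add: image_mset_const_eq)
  finally show ?thesis using P(1) unfolding partition_points_def by blast
qed

lemma perfect_matching_point_eq:
  assumes "P \<in> perfect_matchings {1..n}" "e \<in> pairs n"
  shows "partition_point n P e = (if e \<in> P then 1 else 0)"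
proof -
  have "e \<in> P" if B: "B \<in> P" "e \<subseteq> B" for B
  proof -
    have "card B = 2" using assms(1) B(1) by (simp add: perfect_matching_iff)
    moreover have "card e = 2" using assms(2) by (simp add: pairs_def)
    moreover have "finite B" using \<open>card B = 2\<close> by (intro card_ge_0_finite) simp
    ultimately show ?thesis using B card_subset_eq by metis
  qed
  then show ?thesis using assms(2) by (auto simp: partition_point_def)
qed

theorem theorem3p4:
  fixes a :: nat
  assumes "a \<ge> 1"
  shows "gr_ideal (pairs (2 * a)) (partition_points (2 * a) (replicate_mset a 2))
       \<subseteq> gr_ideal (pairs (2 * a)) (partition_points (2 * a) (replicate_mset 2 a))"
proof -
  define E where "E = pairs (2 * a)"
  define Z where "Z = partition_points (2 * a) (replicate_mset a 2)"
  define L where "L = gr_ideal E (partition_points (2 * a) (replicate_mset 2 a))"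
  have E: "E = edges {1..2 * a}" by (simp add: E_def pairs_eq_edges)
  interpret polynomial_matching_relations "{1..2 * a}" L
    using matching_relations_gr_bipartitions[of "2 * a" a]
    unfolding polynomial_matching_relations_def L_def E_def pairs_eq_edges .
  have "top_component f \<in> L" if f: "f \<in> vanishing_ideal E Z" for f
  proof (rule top_component_in_ideal)
    show "card {1..2 * a} = 2 * a" by simp
    show vars: "vars f \<subseteq> edges {1..2 * a}" using f by (simp add: vanishing_ideal_def E)
    fix P assume P: "P \<in> perfect_matchings {1..2 * a}"
    have "poly_eval (\<lambda>e. if e \<in> P then 1 else 0) f = poly_eval (partition_point (2 * a) P) f"
      using vars perfect_matching_point_eq[OF P] unfolding pairs_eq_edges
      by (intro poly_eval_cong) auto
    then show "poly_eval (\<lambda>e. if e \<in> P then 1 else 0) f = 0"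
      using f perfect_matching_point[OF P] by (simp add: vanishing_ideal_def Z_def)
  qed
  then have "top_component ` {f \<in> vanishing_ideal E Z. f \<noteq> 0} \<subseteq> L" by blast
  then have "gr_ideal E Z \<subseteq> L"
    unfolding gr_ideal_def[of E Z]
    using ring.genideal_minimal[OF cring.axioms(1)[OF cring_poly_ring], of L] ideal_gr_ideal
    unfolding L_def by blast
  then show ?thesis unfolding E_def Z_def L_def .
qed

end
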